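(* Let $\mathbb C$ be a finitely cocomplete homological category. Any action $\psi:(A|G)\to A$ in $\mathbb C$ coincides with the restriction to $G$ of the conjugation action of $A\rtimes_\psi G$ on $A$; formally, $c^{A,A\rtimes_\psi G}\,(1|s_\psi)=\psi$.
   Context: Homological means pointed, finitely complete, regular and protomodular. A subobject is proper if it is the kernel of some map. For objects $A,G$: $i_A,i_G$ are the injections into $A+G$ and $r_G=\langle 0,1\rangle:A+G\to G$; $(A|G)$ is the kernel of the canonical map $b:A+G\to A\times G$, with inclusion $\iota:(A|G)\to A+G$; for $a:A\to A'$, $g:G\to G'$, $(a|g):(A|G)\to(A'|G')$ is the map with $\iota(a|g)=(a+g)\iota$. For $\psi:(A|G)\to A$ let $q_\psi:A+G\to Q_\psi$ be the coequalizer of $\iota$ and $i_A\psi$, $l_\psi=q_\psi i_A$, $s_\psi=q_\psi i_G$, and $p_\psi:Q_\psi\to G$ the unique map with $p_\psi q_\psi=r_G$. $\psi$ is an action of $G$ on $A$ if $l_\psi$ is a monomorphism, and then $A\rtimes_\psi G=Q_\psi$; in that case $l_\psi$ is the kernel of $p_\psi$, so $A$ is a proper subobject of $A\rtimes_\psi G$ via $l_\psi$. For an object $E$, $c_2^E=\nabla_E\,\iota_{E,E}:(E|E)\to E$ with $\nabla_E=\langle 1,1\rangle:E+E\to E$. For a proper subobject $n:N\to E$, the conjugation action $c^{N,E}:(N|E)\to N$ is the unique map with $n\,c^{N,E}=c_2^E(n|1)$. *)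

theory Defs
  imports Main
begin

section \<open>Categories\<close>

record ('o, 'm) cat =
  Obj :: "'o set"
  Arr :: "'m set"
  Dom :: "'m \<Rightarrow> 'o"
  Cod :: "'m \<Rightarrow> 'o"
  Ide :: "'o \<Rightarrow> 'm"
  Comp :: "'m \<Rightarrow> 'm \<Rightarrow> 'm"  (infixl "\<cdot>\<index>" 70)  \<comment> \<open>\<open>g \<cdot> f\<close> is \<open>g\<close> after \<open>f\<close>\<close>

definition hom :: "('o, 'm) cat \<Rightarrow> 'o \<Rightarrow> 'o \<Rightarrow> 'm set" where
  "hom C X Y = {f \<in> Arr C. Dom C f = X \<and> Cod C f = Y}"

locale category =
  fixes C :: "('o, 'm) cat" (structure)
  assumes Dom_in_Obj: "f \<in> Arr C \<Longrightarrow> Dom C f \<in> Obj C"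
    and Cod_in_Obj: "f \<in> Arr C \<Longrightarrow> Cod C f \<in> Obj C"
    and Ide_in_hom: "X \<in> Obj C \<Longrightarrow> Ide C X \<in> hom C X X"
    and Comp_in_hom: "f \<in> hom C X Y \<Longrightarrow> g \<in> hom C Y Z \<Longrightarrow> g \<cdot> f \<in> hom C X Z"
    and Ide_left: "f \<in> hom C X Y \<Longrightarrow> Ide C Y \<cdot> f = f"
    and Ide_right: "f \<in> hom C X Y \<Longrightarrow> f \<cdot> Ide C X = f"
    and Comp_assoc: "f \<in> hom C W X \<Longrightarrow> g \<in> hom C X Y \<Longrightarrow> h \<in> hom C Y Z \<Longrightarrow>
                     (h \<cdot> g) \<cdot> f = h \<cdot> (g \<cdot> f)"

definition mono_arrow :: "('o, 'm) cat \<Rightarrow> 'm \<Rightarrow> bool" where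
  "mono_arrow C f \<longleftrightarrow> f \<in> Arr C \<and>
     (\<forall>W. \<forall>g \<in> hom C W (Dom C f). \<forall>h \<in> hom C W (Dom C f).
        f \<cdot>\<^bsub>C\<^esub> g = f \<cdot>\<^bsub>C\<^esub> h \<longrightarrow> g = h)"

definition iso_arrow :: "('o, 'm) cat \<Rightarrow> 'm \<Rightarrow> bool" where
  "iso_arrow C f \<longleftrightarrow> f \<in> Arr C \<and>
     (\<exists>g \<in> hom C (Cod C f) (Dom C f).
        g \<cdot>\<^bsub>C\<^esub> f = Ide C (Dom C f) \<and> f \<cdot>\<^bsub>C\<^esub> g = Ide C (Cod C f))"


section \<open>Finite limits and colimits\<close>

definition is_functor ::
  "('j, 'k) cat \<Rightarrow> ('o, 'm) cat \<Rightarrow> ('j \<Rightarrow> 'o) \<Rightarrow> ('k \<Rightarrow> 'm) \<Rightarrow> bool" where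
  "is_functor J C Fo Fm \<longleftrightarrow>
     (\<forall>j \<in> Obj J. Fo j \<in> Obj C \<and> Fm (Ide J j) = Ide C (Fo j)) \<and>
     (\<forall>u \<in> Arr J. Fm u \<in> hom C (Fo (Dom J u)) (Fo (Cod J u))) \<and>
     (\<forall>u \<in> Arr J. \<forall>v \<in> Arr J. Dom J v = Cod J u \<longrightarrow>
        Fm (v \<cdot>\<^bsub>J\<^esub> u) = Fm v \<cdot>\<^bsub>C\<^esub> Fm u)"

definition is_cone ::
  "('j, 'k) cat \<Rightarrow> ('o, 'm) cat \<Rightarrow> ('j \<Rightarrow> 'o) \<Rightarrow> ('k \<Rightarrow> 'm) \<Rightarrow> 'o \<Rightarrow> ('j \<Rightarrow> 'm) \<Rightarrow> bool" where
  "is_cone J C Fo Fm X c \<longleftrightarrow> X \<in> Obj C \<and>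
     (\<forall>j \<in> Obj J. c j \<in> hom C X (Fo j)) \<and>
     (\<forall>u \<in> Arr J. Fm u \<cdot>\<^bsub>C\<^esub> c (Dom J u) = c (Cod J u))"

definition is_limit ::
  "('j, 'k) cat \<Rightarrow> ('o, 'm) cat \<Rightarrow> ('j \<Rightarrow> 'o) \<Rightarrow> ('k \<Rightarrow> 'm) \<Rightarrow> 'o \<Rightarrow> ('j \<Rightarrow> 'm) \<Rightarrow> bool" where
  "is_limit J C Fo Fm X c \<longleftrightarrow> is_cone J C Fo Fm X c \<and>
     (\<forall>Y d. is_cone J C Fo Fm Y d \<longrightarrow>
        (\<exists>!h. h \<in> hom C Y X \<and> (\<forall>j \<in> Obj J. c j \<cdot>\<^bsub>C\<^esub> h = d j)))"

definition is_cocone ::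
  "('j, 'k) cat \<Rightarrow> ('o, 'm) cat \<Rightarrow> ('j \<Rightarrow> 'o) \<Rightarrow> ('k \<Rightarrow> 'm) \<Rightarrow> 'o \<Rightarrow> ('j \<Rightarrow> 'm) \<Rightarrow> bool" where
  "is_cocone J C Fo Fm X c \<longleftrightarrow> X \<in> Obj C \<and>
     (\<forall>j \<in> Obj J. c j \<in> hom C (Fo j) X) \<and>
     (\<forall>u \<in> Arr J. c (Cod J u) \<cdot>\<^bsub>C\<^esub> Fm u = c (Dom J u))"

definition is_colimit ::
  "('j, 'k) cat \<Rightarrow> ('o, 'm) cat \<Rightarrow> ('j \<Rightarrow> 'o) \<Rightarrow> ('k \<Rightarrow> 'm) \<Rightarrow> 'o \<Rightarrow> ('j \<Rightarrow> 'm) \<Rightarrow> bool" where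
  "is_colimit J C Fo Fm X c \<longleftrightarrow> is_cocone J C Fo Fm X c \<and>
     (\<forall>Y d. is_cocone J C Fo Fm Y d \<longrightarrow>
        (\<exists>!h. h \<in> hom C X Y \<and> (\<forall>j \<in> Obj J. h \<cdot>\<^bsub>C\<^esub> c j = d j)))"

text \<open>Every finite category is isomorphic to one whose objects and arrows are natural
  numbers, so it suffices to let the shape \<open>J\<close> range over those.\<close>

definition finitely_complete :: "('o, 'm) cat \<Rightarrow> bool" where
  "finitely_complete C \<longleftrightarrow>
     (\<forall>(J :: (nat, nat) cat) Fo Fm.
        category J \<and> finite (Obj J) \<and> finite (Arr J) \<and> is_functor J C Fo Fm \<longrightarrow>
        (\<exists>X c. is_limit J C Fo Fm X c))"

definition finitely_cocomplete :: "('o, 'm) cat \<Rightarrow> bool" where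
  "finitely_cocomplete C \<longleftrightarrow>
     (\<forall>(J :: (nat, nat) cat) Fo Fm.
        category J \<and> finite (Obj J) \<and> finite (Arr J) \<and> is_functor J C Fo Fm \<longrightarrow>
        (\<exists>X c. is_colimit J C Fo Fm X c))"

text \<open>In the following predicates the (co)limit object is not a separate argument: it is
  the common domain (codomain) of the structure arrows.\<close>

definition is_product :: "('o, 'm) cat \<Rightarrow> 'o \<Rightarrow> 'o \<Rightarrow> 'm \<Rightarrow> 'm \<Rightarrow> bool" where
  "is_product C A B p q \<longleftrightarrow>
     p \<in> hom C (Dom C p) A \<and> q \<in> hom C (Dom C p) B \<and>
     (\<forall>W. \<forall>f \<in> hom C W A. \<forall>g \<in> hom C W B.
        \<exists>!h. h \<in> hom C W (Dom C p) \<and> p \<cdot>\<^bsub>C\<^esub> h = f \<and> q \<cdot>\<^bsub>C\<^esub> h = g)"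

definition is_coproduct :: "('o, 'm) cat \<Rightarrow> 'o \<Rightarrow> 'o \<Rightarrow> 'm \<Rightarrow> 'm \<Rightarrow> bool" where
  "is_coproduct C A B i j \<longleftrightarrow>
     i \<in> hom C A (Cod C i) \<and> j \<in> hom C B (Cod C i) \<and>
     (\<forall>W. \<forall>f \<in> hom C A W. \<forall>g \<in> hom C B W.
        \<exists>!h. h \<in> hom C (Cod C i) W \<and> h \<cdot>\<^bsub>C\<^esub> i = f \<and> h \<cdot>\<^bsub>C\<^esub> j = g)"

definition is_coequalizer :: "('o, 'm) cat \<Rightarrow> 'm \<Rightarrow> 'm \<Rightarrow> 'm \<Rightarrow> bool" where
  "is_coequalizer C f g q \<longleftrightarrow>
     f \<in> Arr C \<and> g \<in> hom C (Dom C f) (Cod C f) \<and>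
     q \<in> hom C (Cod C f) (Cod C q) \<and> q \<cdot>\<^bsub>C\<^esub> f = q \<cdot>\<^bsub>C\<^esub> g \<and>
     (\<forall>W. \<forall>h \<in> hom C (Cod C f) W. h \<cdot>\<^bsub>C\<^esub> f = h \<cdot>\<^bsub>C\<^esub> g \<longrightarrow>
        (\<exists>!k. k \<in> hom C (Cod C q) W \<and> k \<cdot>\<^bsub>C\<^esub> q = h))"

text \<open>\<open>is_pullback C f g p q\<close>: the square \<open>f \<cdot> p = g \<cdot> q\<close> is a pullback, so that \<open>q\<close> is the
  pullback of \<open>f\<close> along \<open>g\<close>.\<close>

definition is_pullback :: "('o, 'm) cat \<Rightarrow> 'm \<Rightarrow> 'm \<Rightarrow> 'm \<Rightarrow> 'm \<Rightarrow> bool" where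
  "is_pullback C f g p q \<longleftrightarrow>
     f \<in> Arr C \<and> g \<in> Arr C \<and> Cod C f = Cod C g \<and>
     p \<in> hom C (Dom C p) (Dom C f) \<and> q \<in> hom C (Dom C p) (Dom C g) \<and>
     f \<cdot>\<^bsub>C\<^esub> p = g \<cdot>\<^bsub>C\<^esub> q \<and>
     (\<forall>W. \<forall>u \<in> hom C W (Dom C f). \<forall>v \<in> hom C W (Dom C g). f \<cdot>\<^bsub>C\<^esub> u = g \<cdot>\<^bsub>C\<^esub> v \<longrightarrow>
        (\<exists>!h. h \<in> hom C W (Dom C p) \<and> p \<cdot>\<^bsub>C\<^esub> h = u \<and> q \<cdot>\<^bsub>C\<^esub> h = v))"


section \<open>Homological categories\<close>

definition zero_object :: "('o, 'm) cat \<Rightarrow> 'o \<Rightarrow> bool" where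
  "zero_object C Z \<longleftrightarrow> Z \<in> Obj C \<and>
     (\<forall>X \<in> Obj C. (\<exists>!f. f \<in> hom C X Z) \<and> (\<exists>!f. f \<in> hom C Z X))"

definition pointed :: "('o, 'm) cat \<Rightarrow> bool" where
  "pointed C \<longleftrightarrow> (\<exists>Z. zero_object C Z)"

definition regular_epi :: "('o, 'm) cat \<Rightarrow> 'm \<Rightarrow> bool" where
  "regular_epi C q \<longleftrightarrow> (\<exists>f g. is_coequalizer C f g q)"

definition regular :: "('o, 'm) cat \<Rightarrow> bool" where
  "regular C \<longleftrightarrow> finitely_complete C \<and>
     (\<forall>f p q. is_pullback C f f p q \<longrightarrow> (\<exists>e. is_coequalizer C p q e)) \<and>
     (\<forall>f g p q. is_pullback C f g p q \<and> regular_epi C f \<longrightarrow> regular_epi C q)"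

text \<open>Bourn's definition: for every \<open>v : B' \<rightarrow> B\<close>, the change-of-base functor
  from points over \<open>B\<close> to points over \<open>B'\<close> reflects isomorphisms. A point over \<open>B\<close> is a
  pair \<open>(p, s)\<close> with \<open>p \<cdot> s = 1\<close>; below, \<open>h\<close> is a morphism of points
  \<open>(p, s) \<rightarrow> (p', s')\<close> and \<open>k\<close> is its image under pullback along \<open>v\<close>. The sections of
  the pulled back points are determined by \<open>s\<close>, \<open>s'\<close> and are automatically preserved by
  \<open>k\<close>, hence do not occur.\<close>

definition is_point :: "('o, 'm) cat \<Rightarrow> 'm \<Rightarrow> 'm \<Rightarrow> bool" where
  "is_point C p s \<longleftrightarrow> p \<in> Arr C \<and> s \<in> hom C (Cod C p) (Dom C p) \<and>
     p \<cdot>\<^bsub>C\<^esub> s = Ide C (Cod C p)"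

definition protomodular :: "('o, 'm) cat \<Rightarrow> bool" where
  "protomodular C \<longleftrightarrow>
     (\<forall>p s p' s' h v w r w' r' k.
        is_point C p s \<and> is_point C p' s' \<and> Cod C p = Cod C p' \<and>
        h \<in> hom C (Dom C p) (Dom C p') \<and> p' \<cdot>\<^bsub>C\<^esub> h = p \<and> h \<cdot>\<^bsub>C\<^esub> s = s' \<and>
        is_pullback C p v w r \<and> is_pullback C p' v w' r' \<and>
        k \<in> hom C (Dom C r) (Dom C r') \<and> w' \<cdot>\<^bsub>C\<^esub> k = h \<cdot>\<^bsub>C\<^esub> w \<and> r' \<cdot>\<^bsub>C\<^esub> k = r \<and>
        iso_arrow C k \<longrightarrow> iso_arrow C h)"

definition homological :: "('o, 'm) cat \<Rightarrow> bool" where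
  "homological C \<longleftrightarrow> category C \<and> pointed C \<and> finitely_complete C \<and> regular C \<and> protomodular C"


section \<open>Kernels and chosen (co)products\<close>

definition zero_arrow :: "('o, 'm) cat \<Rightarrow> 'o \<Rightarrow> 'o \<Rightarrow> 'm" where
  "zero_arrow C X Y =
     (THE f. \<exists>Z. zero_object C Z \<and> (\<exists>g \<in> hom C X Z. \<exists>h \<in> hom C Z Y. f = h \<cdot>\<^bsub>C\<^esub> g))"

definition is_kernel :: "('o, 'm) cat \<Rightarrow> 'm \<Rightarrow> 'm \<Rightarrow> bool" where
  "is_kernel C f k \<longleftrightarrow>
     f \<in> Arr C \<and> k \<in> hom C (Dom C k) (Dom C f) \<and>
     f \<cdot>\<^bsub>C\<^esub> k = zero_arrow C (Dom C k) (Cod C f) \<and>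
     (\<forall>W. \<forall>u \<in> hom C W (Dom C f). f \<cdot>\<^bsub>C\<^esub> u = zero_arrow C W (Cod C f) \<longrightarrow>
        (\<exists>!h. h \<in> hom C W (Dom C k) \<and> k \<cdot>\<^bsub>C\<^esub> h = u))"

definition proper_subobject :: "('o, 'm) cat \<Rightarrow> 'm \<Rightarrow> bool" where
  "proper_subobject C n \<longleftrightarrow> (\<exists>f. is_kernel C f n)"

definition product_cone :: "('o, 'm) cat \<Rightarrow> 'o \<Rightarrow> 'o \<Rightarrow> 'm \<times> 'm" where
  "product_cone C A B = (SOME (p, q). is_product C A B p q)"

definition proj1 :: "('o, 'm) cat \<Rightarrow> 'o \<Rightarrow> 'o \<Rightarrow> 'm" where
  "proj1 C A B = fst (product_cone C A B)"

definition proj2 :: "('o, 'm) cat \<Rightarrow> 'o \<Rightarrow> 'o \<Rightarrow> 'm" where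
  "proj2 C A B = snd (product_cone C A B)"

definition product :: "('o, 'm) cat \<Rightarrow> 'o \<Rightarrow> 'o \<Rightarrow> 'o" where
  "product C A B = Dom C (proj1 C A B)"

definition pairing :: "('o, 'm) cat \<Rightarrow> 'm \<Rightarrow> 'm \<Rightarrow> 'm" where
  "pairing C f g = (THE h. h \<in> hom C (Dom C f) (product C (Cod C f) (Cod C g)) \<and>
     proj1 C (Cod C f) (Cod C g) \<cdot>\<^bsub>C\<^esub> h = f \<and> proj2 C (Cod C f) (Cod C g) \<cdot>\<^bsub>C\<^esub> h = g)"

definition coproduct_cocone :: "('o, 'm) cat \<Rightarrow> 'o \<Rightarrow> 'o \<Rightarrow> 'm \<times> 'm" where
  "coproduct_cocone C A B = (SOME (i, j). is_coproduct C A B i j)"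

definition inj1 :: "('o, 'm) cat \<Rightarrow> 'o \<Rightarrow> 'o \<Rightarrow> 'm" where
  "inj1 C A B = fst (coproduct_cocone C A B)"

definition inj2 :: "('o, 'm) cat \<Rightarrow> 'o \<Rightarrow> 'o \<Rightarrow> 'm" where
  "inj2 C A B = snd (coproduct_cocone C A B)"

definition coproduct :: "('o, 'm) cat \<Rightarrow> 'o \<Rightarrow> 'o \<Rightarrow> 'o" where
  "coproduct C A B = Cod C (inj1 C A B)"

definition copairing :: "('o, 'm) cat \<Rightarrow> 'm \<Rightarrow> 'm \<Rightarrow> 'm" where
  "copairing C f g = (THE h. h \<in> hom C (coproduct C (Dom C f) (Dom C g)) (Cod C f) \<and>
     h \<cdot>\<^bsub>C\<^esub> inj1 C (Dom C f) (Dom C g) = f \<and> h \<cdot>\<^bsub>C\<^esub> inj2 C (Dom C f) (Dom C g) = g)"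

definition coproduct_map :: "('o, 'm) cat \<Rightarrow> 'm \<Rightarrow> 'm \<Rightarrow> 'm" where
  "coproduct_map C a g = copairing C (inj1 C (Cod C a) (Cod C g) \<cdot>\<^bsub>C\<^esub> a)
                                     (inj2 C (Cod C a) (Cod C g) \<cdot>\<^bsub>C\<^esub> g)"


section \<open>The cosmash product \<open>(A|G)\<close>\<close>

text \<open>\<open>retr2 C A G\<close> is the map \<open>r\<^sub>G : A + G \<rightarrow> G\<close>.\<close>

definition retr1 :: "('o, 'm) cat \<Rightarrow> 'o \<Rightarrow> 'o \<Rightarrow> 'm" where
  "retr1 C A G = copairing C (Ide C A) (zero_arrow C G A)"

definition retr2 :: "('o, 'm) cat \<Rightarrow> 'o \<Rightarrow> 'o \<Rightarrow> 'm" where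
  "retr2 C A G = copairing C (zero_arrow C A G) (Ide C G)"

definition sum_to_prod :: "('o, 'm) cat \<Rightarrow> 'o \<Rightarrow> 'o \<Rightarrow> 'm" where
  "sum_to_prod C A G = pairing C (retr1 C A G) (retr2 C A G)"

definition cosmash_incl :: "('o, 'm) cat \<Rightarrow> 'o \<Rightarrow> 'o \<Rightarrow> 'm" where
  "cosmash_incl C A G = (SOME k. is_kernel C (sum_to_prod C A G) k)"

definition cosmash :: "('o, 'm) cat \<Rightarrow> 'o \<Rightarrow> 'o \<Rightarrow> 'o" where
  "cosmash C A G = Dom C (cosmash_incl C A G)"

definition cosmash_map :: "('o, 'm) cat \<Rightarrow> 'm \<Rightarrow> 'm \<Rightarrow> 'm" where
  "cosmash_map C a g =
     (THE h. h \<in> hom C (cosmash C (Dom C a) (Dom C g)) (cosmash C (Cod C a) (Cod C g)) \<and>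
        cosmash_incl C (Cod C a) (Cod C g) \<cdot>\<^bsub>C\<^esub> h =
        coproduct_map C a g \<cdot>\<^bsub>C\<^esub> cosmash_incl C (Dom C a) (Dom C g))"


section \<open>Actions, semidirect products and conjugation\<close>

text \<open>\<open>act_q\<close>, \<open>act_Q\<close>, \<open>act_l\<close>, \<open>act_s\<close>, \<open>act_p\<close> are \<open>q\<^sub>\<psi>\<close>, \<open>Q\<^sub>\<psi>\<close>, \<open>l\<^sub>\<psi>\<close>, \<open>s\<^sub>\<psi>\<close>, \<open>p\<^sub>\<psi>\<close> for
  \<open>\<psi> : (A|G) \<rightarrow> A\<close>.\<close>

definition act_q :: "('o, 'm) cat \<Rightarrow> 'o \<Rightarrow> 'o \<Rightarrow> 'm \<Rightarrow> 'm" where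
  "act_q C A G \<psi> =
     (SOME q. is_coequalizer C (cosmash_incl C A G) (inj1 C A G \<cdot>\<^bsub>C\<^esub> \<psi>) q)"

definition act_Q :: "('o, 'm) cat \<Rightarrow> 'o \<Rightarrow> 'o \<Rightarrow> 'm \<Rightarrow> 'o" where
  "act_Q C A G \<psi> = Cod C (act_q C A G \<psi>)"

definition act_l :: "('o, 'm) cat \<Rightarrow> 'o \<Rightarrow> 'o \<Rightarrow> 'm \<Rightarrow> 'm" where
  "act_l C A G \<psi> = act_q C A G \<psi> \<cdot>\<^bsub>C\<^esub> inj1 C A G"

definition act_s :: "('o, 'm) cat \<Rightarrow> 'o \<Rightarrow> 'o \<Rightarrow> 'm \<Rightarrow> 'm" where
  "act_s C A G \<psi> = act_q C A G \<psi> \<cdot>\<^bsub>C\<^esub> inj2 C A G"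

definition act_p :: "('o, 'm) cat \<Rightarrow> 'o \<Rightarrow> 'o \<Rightarrow> 'm \<Rightarrow> 'm" where
  "act_p C A G \<psi> =
     (THE p. p \<in> hom C (act_Q C A G \<psi>) G \<and> p \<cdot>\<^bsub>C\<^esub> act_q C A G \<psi> = retr2 C A G)"

definition is_action :: "('o, 'm) cat \<Rightarrow> 'o \<Rightarrow> 'o \<Rightarrow> 'm \<Rightarrow> bool" where
  "is_action C A G \<psi> \<longleftrightarrow> A \<in> Obj C \<and> G \<in> Obj C \<and>
     \<psi> \<in> hom C (cosmash C A G) A \<and> mono_arrow C (act_l C A G \<psi>)"

definition commutator_map :: "('o, 'm) cat \<Rightarrow> 'o \<Rightarrow> 'm" where
  "commutator_map C E = copairing C (Ide C E) (Ide C E) \<cdot>\<^bsub>C\<^esub> cosmash_incl C E E"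

text \<open>\<open>conj_action C N E n\<close> is meaningful when \<open>n : N \<rightarrow> E\<close> satisfies
  \<open>proper_subobject C n\<close>. For an action \<open>\<psi>\<close>, the arrow \<open>act_l C A G \<psi>\<close> satisfies this, being
  a kernel of \<open>act_p C A G \<psi>\<close>.\<close>

definition conj_action :: "('o, 'm) cat \<Rightarrow> 'o \<Rightarrow> 'o \<Rightarrow> 'm \<Rightarrow> 'm" where
  "conj_action C N E n =
     (THE c. c \<in> hom C (cosmash C N E) N \<and>
        n \<cdot>\<^bsub>C\<^esub> c = commutator_map C E \<cdot>\<^bsub>C\<^esub> cosmash_map C n (Ide C E))"

end

theory Submission
  imports Defs
begin

text \<open>
  Write \<open>E = A \<rtimes>\<^sub>\<psi> G\<close> and \<open>q, l, s, p\<close> for the structure maps. Since \<open>p\<close> annihilates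
  \<open>\<nabla> (l + 1) \<iota>\<close>, the conjugation action \<open>c\<close> exists as soon as \<open>l\<close> is a kernel of \<open>p\<close>, and then
  \<open>l c (1|s) = \<nabla> (l + 1) (1 + s) \<iota> = q \<iota> = l \<psi>\<close>, so that \<open>c (1|s) = \<psi>\<close> because \<open>l\<close> is monic.

  To see that \<open>l\<close> is a kernel, let \<open>k : K \<rightarrow> E\<close> be a kernel of \<open>p\<close> and \<open>l = k m\<close>. The pullback
  \<open>q' : P \<rightarrow> K\<close> of \<open>q\<close> along \<open>k\<close> is a regular epimorphism, and \<open>P\<close> is a split extension of \<open>A\<close> by
  \<open>(A|G)\<close>. By protomodularity no strictly smaller subobject of \<open>P\<close> contains both \<open>A\<close> and \<open>(A|G)\<close>; as the
  restrictions of \<open>q'\<close> to these are \<open>m\<close> and \<open>m \<psi>\<close>, the map \<open>q'\<close> factors through the monomorphism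
  \<open>m\<close>, which is therefore invertible.
\<close>

section \<open>Existence of particular limits and colimits\<close>

text \<open>The category freely generated by a graph without paths of length two: the first \<open>n\<close> arrows
  are the identities, and a composite always has an identity as one of its factors.\<close>

definition graph_shape :: "nat \<Rightarrow> (nat \<times> nat) list \<Rightarrow> (nat, nat) cat" where
  "graph_shape n es = \<lparr>Obj = {..<n}, Arr = {..<n + length es},
     Dom = (\<lambda>u. if u < n then u else fst (es ! (u - n))),
     Cod = (\<lambda>u. if u < n then u else snd (es ! (u - n))),
     Ide = (\<lambda>j. j), Comp = (\<lambda>v u. if v < n then u else v)\<rparr>"

text \<open>No vertex is both the end of an edge and the start of one, which also forbids loops. A
  composable pair of arrows in \<open>graph_shape\<close> therefore has an identity among its
  factors, and the case distinction in \<open>Comp\<close> returns the other factor.\<close>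

definition bipartite :: "nat \<Rightarrow> (nat \<times> nat) list \<Rightarrow> bool" where
  "bipartite n es \<longleftrightarrow> (\<forall>e \<in> set es. fst e < n \<and> snd e < n \<and> (\<forall>e' \<in> set es. snd e \<noteq> fst e'))"

lemma category_graph_shape:
  assumes "bipartite n es"
  shows "category (graph_shape n es)"
proof -
  have b: "fst (es ! i) < n" "snd (es ! i) < n" if "i < length es" for i
    using assms that by (auto simp: bipartite_def)
  \<comment> \<open>This is the one case in which \<open>Comp\<close> would give a wrong composite:
    two genuine edges in succession.\<close>
  have nb: False if "fst (es ! (v - n)) = snd (es ! (u - n))" "\<not> u < n" "\<not> v < n"
      "u < n + length es" "v < n + length es" for u v
  proof -
    have "es ! (u - n) \<in> set es" "es ! (v - n) \<in> set es" using that by auto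
    then show False using assms that(1) unfolding bipartite_def by metis
  qed
  show ?thesis
    by unfold_locales (auto simp: graph_shape_def hom_def b dest: nb split: if_splits)
qed

lemma all_less_2: "(\<forall>j<2. P j) \<longleftrightarrow> P 0 \<and> P (1 :: nat)"
  by (simp add: All_less_Suc numeral_2_eq_2 conj_ac)

lemma all_less_3: "(\<forall>j<3. P j) \<longleftrightarrow> P 0 \<and> P 1 \<and> P (2 :: nat)"
  by (simp add: numeral_3_eq_3 All_less_Suc numeral_2_eq_2 conj_ac)

context category
begin

section \<open>Diagrams, cones and cocones over a graph\<close>

lemma homD:
  assumes "f \<in> hom C X Y"
  shows "f \<in> Arr C" "Dom C f = X" "Cod C f = Y" "X \<in> Obj C" "Y \<in> Obj C"
  using assms Dom_in_Obj Cod_in_Obj by (auto simp: hom_def)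

text \<open>A diagram on a graph is given by its objects \<open>Fo\<close> and a list
  \<open>fs\<close> with one arrow per edge. Edge number \<open>i\<close> is the arrow
  \<open>n + i\<close> of the shape, hence the index shift; the arrows below \<open>n\<close> are
  identities.\<close>

definition graph_functor :: "nat \<Rightarrow> (nat \<Rightarrow> 'o) \<Rightarrow> 'm list \<Rightarrow> nat \<Rightarrow> 'm" where
  "graph_functor n Fo fs u = (if u < n then Ide C (Fo u) else fs ! (u - n))"

lemma is_functor_graph:
  assumes b: "bipartite n es"
    and Fo: "\<And>j. j < n \<Longrightarrow> Fo j \<in> Obj C"
    and fs: "\<And>i. i < length es \<Longrightarrow> fs ! i \<in> hom C (Fo (fst (es ! i))) (Fo (snd (es ! i)))"
  shows "is_functor (graph_shape n es) C Fo (graph_functor n Fo fs)"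
proof -
  have nb: "snd (es ! i) \<noteq> fst (es ! j)" if "i < length es" "j < length es" for i j
    using b that by (auto simp: bipartite_def)
  have arr: "graph_functor n Fo fs u \<in>
      hom C (Fo (Dom (graph_shape n es) u)) (Fo (Cod (graph_shape n es) u))"
    if "u < n + length es" for u
    using that fs[of "u - n"] Ide_in_hom[OF Fo] by (auto simp: graph_functor_def graph_shape_def)
  have comp: "graph_functor n Fo fs (Comp (graph_shape n es) v u) =
      graph_functor n Fo fs v \<cdot> graph_functor n Fo fs u"
    if "u < n + length es" "v < n + length es"
      "Dom (graph_shape n es) v = Cod (graph_shape n es) u" for u v
  proof (cases "v < n")
    case True
    then have "v = Cod (graph_shape n es) u" using that by (simp add: graph_shape_def)
    then show ?thesis using True Ide_left[OF arr[OF that(1)]]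
      by (simp add: graph_functor_def graph_shape_def)
  next
    case False
    \<comment> \<open>Here \<open>v\<close> is an edge, so \<open>u\<close> cannot be one as well;
      it must be the identity at the source of \<open>v\<close>.\<close>
    have "u < n"
    proof (rule ccontr)
      assume "\<not> u < n"
      then have "u - n < length es" "v - n < length es" "fst (es ! (v - n)) = snd (es ! (u - n))"
        using that False by (auto simp: graph_shape_def)
      then show False using nb by metis
    qed
    then have "u = Dom (graph_shape n es) v" using that by (simp add: graph_shape_def)
    then show ?thesis using False \<open>u < n\<close> Ide_right[OF arr[OF that(2)]]
      by (simp add: graph_functor_def graph_shape_def)
  qed
  show ?thesis
    using Fo arr comp unfolding is_functor_def
    by (auto simp: graph_shape_def graph_functor_def)
qed

text \<open>Commutation with the identities of the shape is automatic, so a cone is a family of legs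
  subject to one equation per edge. The universal properties below are read off from this form and
  its dual.\<close>

lemma is_cone_graph:
  "is_cone (graph_shape n es) C Fo (graph_functor n Fo fs) X c \<longleftrightarrow> X \<in> Obj C \<and>
     (\<forall>j<n. c j \<in> hom C X (Fo j)) \<and> (\<forall>i<length es. fs ! i \<cdot> c (fst (es ! i)) = c (snd (es ! i)))"
    (is "?L \<longleftrightarrow> ?R")
proof
  assume L: ?L
  have "fs ! i \<cdot> c (fst (es ! i)) = c (snd (es ! i))" if "i < length es" for i
  proof -
    have "n + i \<in> Arr (graph_shape n es)" using that by (simp add: graph_shape_def)
    then have "graph_functor n Fo fs (n + i) \<cdot> c (Dom (graph_shape n es) (n + i)) =
        c (Cod (graph_shape n es) (n + i))"
      using L unfolding is_cone_def by blast
    then show ?thesis by (simp add: graph_shape_def graph_functor_def)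
  qed
  then show ?R using L by (auto simp: is_cone_def graph_shape_def)
next
  assume R: ?R
  have "graph_functor n Fo fs u \<cdot> c (Dom (graph_shape n es) u) = c (Cod (graph_shape n es) u)"
    if "u < n + length es" for u
  proof (cases "u < n")
    case True
    then show ?thesis using R Ide_left[of "c u" X "Fo u"] by (simp add: graph_functor_def graph_shape_def)
  next
    case False
    then have "u - n < length es" using that by simp
    then show ?thesis using R False by (simp add: graph_functor_def graph_shape_def)
  qed
  then show ?L using R by (auto simp: is_cone_def graph_shape_def)
qed

lemma is_cocone_graph:
  "is_cocone (graph_shape n es) C Fo (graph_functor n Fo fs) X c \<longleftrightarrow> X \<in> Obj C \<and>
     (\<forall>j<n. c j \<in> hom C (Fo j) X) \<and> (\<forall>i<length es. c (snd (es ! i)) \<cdot> fs ! i = c (fst (es ! i)))"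
    (is "?L \<longleftrightarrow> ?R")
proof
  assume L: ?L
  have "c (snd (es ! i)) \<cdot> fs ! i = c (fst (es ! i))" if "i < length es" for i
  proof -
    have "n + i \<in> Arr (graph_shape n es)" using that by (simp add: graph_shape_def)
    then have "c (Cod (graph_shape n es) (n + i)) \<cdot> graph_functor n Fo fs (n + i) =
        c (Dom (graph_shape n es) (n + i))"
      using L unfolding is_cocone_def by blast
    then show ?thesis by (simp add: graph_shape_def graph_functor_def)
  qed
  then show ?R using L by (auto simp: is_cocone_def graph_shape_def)
next
  assume R: ?R
  have "c (Cod (graph_shape n es) u) \<cdot> graph_functor n Fo fs u = c (Dom (graph_shape n es) u)"
    if "u < n + length es" for u
  proof (cases "u < n")
    case True
    then show ?thesis using R Ide_right[of "c u" "Fo u" X] by (simp add: graph_functor_def graph_shape_def)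
  next
    case False
    then have "u - n < length es" using that by simp
    then show ?thesis using R False by (simp add: graph_functor_def graph_shape_def)
  qed
  then show ?L using R by (auto simp: is_cocone_def graph_shape_def)
qed

section \<open>Pullbacks, coproducts and coequalizers from graph-shaped diagrams\<close>

lemma ex_graph_limit:
  assumes "finitely_complete C" "bipartite n es"
    and "\<And>j. j < n \<Longrightarrow> Fo j \<in> Obj C"
    and "\<And>i. i < length es \<Longrightarrow> fs ! i \<in> hom C (Fo (fst (es ! i))) (Fo (snd (es ! i)))"
  obtains X c where "is_limit (graph_shape n es) C Fo (graph_functor n Fo fs) X c"
proof -
  have "finite (Obj (graph_shape n es))" "finite (Arr (graph_shape n es))"
    by (simp_all add: graph_shape_def)
  then show ?thesis
    using assms(1) category_graph_shape[OF assms(2)] is_functor_graph[OF assms(2-4)] that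
    unfolding finitely_complete_def by blast
qed

lemma ex_graph_colimit:
  assumes "finitely_cocomplete C" "bipartite n es"
    and "\<And>j. j < n \<Longrightarrow> Fo j \<in> Obj C"
    and "\<And>i. i < length es \<Longrightarrow> fs ! i \<in> hom C (Fo (fst (es ! i))) (Fo (snd (es ! i)))"
  obtains X c where "is_colimit (graph_shape n es) C Fo (graph_functor n Fo fs) X c"
proof -
  have "finite (Obj (graph_shape n es))" "finite (Arr (graph_shape n es))"
    by (simp_all add: graph_shape_def)
  then show ?thesis
    using assms(1) category_graph_shape[OF assms(2)] is_functor_graph[OF assms(2-4)] that
    unfolding finitely_cocomplete_def by blast
qed

text \<open>The shape is a cospan: vertices 0 and 1 carry \<open>X\<close> and \<open>Y\<close>,
  vertex 2 carries \<open>B\<close>. The leg at vertex 2 is the common composite and thus determined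
  by the other two, so cones correspond to commuting squares.\<close>

lemma ex_pullback:
  assumes fc: "finitely_complete C" and f: "f \<in> hom C X B" and g: "g \<in> hom C Y B"
  obtains p q where "is_pullback C f g p q"
proof -
  let ?es = "[(0, 2), (1, 2)] :: (nat \<times> nat) list"
  let ?Fo = "(!) [X, Y, B]"
  let ?fs = "[f, g]"
  have b: "bipartite 3 ?es" by (simp add: bipartite_def)
  have Fo: "\<forall>j<3. ?Fo j \<in> Obj C" unfolding all_less_3 using homD(4,5)[OF f] homD(4)[OF g] by simp
  have fs: "\<forall>i<2. ?fs ! i \<in> hom C (?Fo (fst (?es ! i))) (?Fo (snd (?es ! i)))"
    unfolding all_less_2 using f g by simp
  have len: "length ?es = 2" by simp
  obtain P c where lim: "is_limit (graph_shape 3 ?es) C ?Fo (graph_functor 3 ?Fo ?fs) P c"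
    using ex_graph_limit[OF fc b, of ?Fo ?fs] Fo fs len by metis
  have cone: "is_cone (graph_shape 3 ?es) C ?Fo (graph_functor 3 ?Fo ?fs) W d \<longleftrightarrow>
      d 0 \<in> hom C W X \<and> d 1 \<in> hom C W Y \<and> d 2 \<in> hom C W B \<and> f \<cdot> d 0 = d 2 \<and> g \<cdot> d 1 = d 2"
    for W d
  proof -
    have "is_cone (graph_shape 3 ?es) C ?Fo (graph_functor 3 ?Fo ?fs) W d \<longleftrightarrow> W \<in> Obj C \<and>
     (\<forall>j<3. d j \<in> hom C W (?Fo j)) \<and> (\<forall>i<2. ?fs ! i \<cdot> d (fst (?es ! i)) = d (snd (?es ! i)))"
      using is_cone_graph[of 3 ?es ?Fo ?fs W d] len by metis
    also have "\<dots> \<longleftrightarrow> d 0 \<in> hom C W X \<and> d 1 \<in> hom C W Y \<and> d 2 \<in> hom C W B \<and>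
        f \<cdot> d 0 = d 2 \<and> g \<cdot> d 1 = d 2"
      unfolding all_less_3 all_less_2 using homD(4)[of "d 0" W X] by auto
    finally show ?thesis .
  qed
  have c: "c 0 \<in> hom C P X" "c 1 \<in> hom C P Y" "f \<cdot> c 0 = c 2" "g \<cdot> c 1 = c 2"
    using lim unfolding is_limit_def cone by auto
  have ex1: "\<exists>!h. h \<in> hom C W P \<and> c 0 \<cdot> h = u \<and> c 1 \<cdot> h = v"
    if u: "u \<in> hom C W X" and v: "v \<in> hom C W Y" and e: "f \<cdot> u = g \<cdot> v" for W u v
  proof -
    let ?d = "(!) [u, v, f \<cdot> u]"
    have "is_cone (graph_shape 3 ?es) C ?Fo (graph_functor 3 ?Fo ?fs) W ?d"
      unfolding cone using u v e Comp_in_hom[OF u f] by simp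
    then have "\<exists>!h. h \<in> hom C W P \<and> (\<forall>j \<in> Obj (graph_shape 3 ?es). c j \<cdot> h = ?d j)"
      using lim unfolding is_limit_def by blast
    moreover have "(\<forall>j \<in> Obj (graph_shape 3 ?es). c j \<cdot> h = ?d j) \<longleftrightarrow> c 0 \<cdot> h = u \<and> c 1 \<cdot> h = v"
      if h: "h \<in> hom C W P" for h
    proof -
      have "c 2 \<cdot> h = f \<cdot> u" if "c 0 \<cdot> h = u"
        using Comp_assoc[OF h c(1) f] c(3) that by simp
      moreover have "(\<forall>j \<in> Obj (graph_shape 3 ?es). c j \<cdot> h = ?d j) \<longleftrightarrow> (\<forall>j<3. c j \<cdot> h = ?d j)"
        by (auto simp: graph_shape_def)
      ultimately show ?thesis unfolding all_less_3 by auto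
    qed
    ultimately show ?thesis by metis
  qed
  have "is_pullback C f g (c 0) (c 1)"
    using ex1 c homD[OF f] homD[OF g] homD[OF c(1)] unfolding is_pullback_def by simp
  then show ?thesis by (rule that)
qed

text \<open>The shape has two vertices and no edges, so a cocone is an arbitrary pair of arrows with
  a common codomain.\<close>

lemma ex_coproduct:
  assumes fc: "finitely_cocomplete C" and X: "X \<in> Obj C" and Y: "Y \<in> Obj C"
  obtains i j where "is_coproduct C X Y i j"
proof -
  let ?es = "[] :: (nat \<times> nat) list"
  let ?Fo = "(!) [X, Y]"
  let ?fs = "[]"
  have b: "bipartite 2 ?es" by (simp add: bipartite_def)
  have Fo: "\<forall>j<2. ?Fo j \<in> Obj C" unfolding all_less_2 using X Y by simp
  obtain P c where lim: "is_colimit (graph_shape 2 ?es) C ?Fo (graph_functor 2 ?Fo ?fs) P c"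
    using ex_graph_colimit[OF fc b, of ?Fo ?fs] Fo by auto
  have cocone: "is_cocone (graph_shape 2 ?es) C ?Fo (graph_functor 2 ?Fo ?fs) W d \<longleftrightarrow>
      d 0 \<in> hom C X W \<and> d 1 \<in> hom C Y W" for W d
  proof -
    have "is_cocone (graph_shape 2 ?es) C ?Fo (graph_functor 2 ?Fo ?fs) W d \<longleftrightarrow>
        W \<in> Obj C \<and> (\<forall>j<2. d j \<in> hom C (?Fo j) W)"
      using is_cocone_graph[of 2 ?es ?Fo ?fs W d] by simp
    also have "\<dots> \<longleftrightarrow> d 0 \<in> hom C X W \<and> d 1 \<in> hom C Y W"
      unfolding all_less_2 using homD(5)[of "d 0" X W] by auto
    finally show ?thesis .
  qed
  have c: "c 0 \<in> hom C X P" "c 1 \<in> hom C Y P"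
    using lim unfolding is_colimit_def cocone by auto
  have ex1: "\<exists>!h. h \<in> hom C P W \<and> h \<cdot> c 0 = u \<and> h \<cdot> c 1 = v"
    if u: "u \<in> hom C X W" and v: "v \<in> hom C Y W" for W u v
  proof -
    let ?d = "(!) [u, v]"
    have "is_cocone (graph_shape 2 ?es) C ?Fo (graph_functor 2 ?Fo ?fs) W ?d"
      unfolding cocone using u v by simp
    then have "\<exists>!h. h \<in> hom C P W \<and> (\<forall>j \<in> Obj (graph_shape 2 ?es). h \<cdot> c j = ?d j)"
      using lim unfolding is_colimit_def by blast
    moreover have "(\<forall>j \<in> Obj (graph_shape 2 ?es). h \<cdot> c j = ?d j) \<longleftrightarrow> h \<cdot> c 0 = u \<and> h \<cdot> c 1 = v"
      for h
    proof -
      have "(\<forall>j \<in> Obj (graph_shape 2 ?es). h \<cdot> c j = ?d j) \<longleftrightarrow> (\<forall>j<2. h \<cdot> c j = ?d j)"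
        by (auto simp: graph_shape_def)
      then show ?thesis unfolding all_less_2 by auto
    qed
    ultimately show ?thesis by metis
  qed
  have "is_coproduct C X Y (c 0) (c 1)"
    using ex1 c homD[OF c(1)] unfolding is_coproduct_def by simp
  then show ?thesis by (rule that)
qed

text \<open>The shape has two parallel edges. The leg at the source vertex must be
  \<open>h \<cdot> f\<close>, so a cocone amounts to an arrow \<open>h\<close> with
  \<open>h \<cdot> f = h \<cdot> g\<close>.\<close>

lemma ex_coequalizer:
  assumes fc: "finitely_cocomplete C" and f: "f \<in> hom C X Y" and g: "g \<in> hom C X Y"
  obtains q where "is_coequalizer C f g q"
proof -
  let ?es = "[(0, 1), (0, 1)] :: (nat \<times> nat) list"
  let ?Fo = "(!) [X, Y]"
  let ?fs = "[f, g]"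
  have b: "bipartite 2 ?es" by (simp add: bipartite_def)
  have Fo: "\<forall>j<2. ?Fo j \<in> Obj C" unfolding all_less_2 using homD(4,5)[OF f] by simp
  have fs: "\<forall>i<2. ?fs ! i \<in> hom C (?Fo (fst (?es ! i))) (?Fo (snd (?es ! i)))"
    unfolding all_less_2 using f g by simp
  have len: "length ?es = 2" by simp
  obtain P c where lim: "is_colimit (graph_shape 2 ?es) C ?Fo (graph_functor 2 ?Fo ?fs) P c"
    using ex_graph_colimit[OF fc b, of ?Fo ?fs] Fo fs len by metis
  have cocone: "is_cocone (graph_shape 2 ?es) C ?Fo (graph_functor 2 ?Fo ?fs) W d \<longleftrightarrow>
      d 0 \<in> hom C X W \<and> d 1 \<in> hom C Y W \<and> d 1 \<cdot> f = d 0 \<and> d 1 \<cdot> g = d 0" for W d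
  proof -
    have "is_cocone (graph_shape 2 ?es) C ?Fo (graph_functor 2 ?Fo ?fs) W d \<longleftrightarrow> W \<in> Obj C \<and>
     (\<forall>j<2. d j \<in> hom C (?Fo j) W) \<and> (\<forall>i<2. d (snd (?es ! i)) \<cdot> ?fs ! i = d (fst (?es ! i)))"
      using is_cocone_graph[of 2 ?es ?Fo ?fs W d] len by metis
    also have "\<dots> \<longleftrightarrow> d 0 \<in> hom C X W \<and> d 1 \<in> hom C Y W \<and> d 1 \<cdot> f = d 0 \<and> d 1 \<cdot> g = d 0"
      unfolding all_less_2 using homD(5)[of "d 0" X W] by auto
    finally show ?thesis .
  qed
  have c: "c 1 \<in> hom C Y P" "c 1 \<cdot> f = c 0" "c 1 \<cdot> g = c 0"
    using lim unfolding is_colimit_def cocone by auto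
  have ex1: "\<exists>!k. k \<in> hom C P W \<and> k \<cdot> c 1 = h"
    if h: "h \<in> hom C Y W" and e: "h \<cdot> f = h \<cdot> g" for W h
  proof -
    let ?d = "(!) [h \<cdot> f, h]"
    have "is_cocone (graph_shape 2 ?es) C ?Fo (graph_functor 2 ?Fo ?fs) W ?d"
      unfolding cocone using h e Comp_in_hom[OF f h] by simp
    then have "\<exists>!k. k \<in> hom C P W \<and> (\<forall>j \<in> Obj (graph_shape 2 ?es). k \<cdot> c j = ?d j)"
      using lim unfolding is_colimit_def by blast
    moreover have "(\<forall>j \<in> Obj (graph_shape 2 ?es). k \<cdot> c j = ?d j) \<longleftrightarrow> k \<cdot> c 1 = h"
      if k: "k \<in> hom C P W" for k
    proof -
      have "k \<cdot> c 0 = h \<cdot> f" if "k \<cdot> c 1 = h"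
        using Comp_assoc[OF f c(1) k] c(2) that by simp
      moreover have "(\<forall>j \<in> Obj (graph_shape 2 ?es). k \<cdot> c j = ?d j) \<longleftrightarrow> (\<forall>j<2. k \<cdot> c j = ?d j)"
        by (auto simp: graph_shape_def)
      ultimately show ?thesis unfolding all_less_2 by auto
    qed
    ultimately show ?thesis by metis
  qed
  have "is_coequalizer C f g (c 1)"
    using ex1 c homD[OF f] g homD[OF c(1)] unfolding is_coequalizer_def by simp
  then show ?thesis by (rule that)
qed

section \<open>Universal properties with named domains and codomains; monomorphisms\<close>

lemma is_coequalizer_iff:
  assumes "f \<in> hom C X Y" "g \<in> hom C X Y" "q \<in> hom C Y Q"
  shows "is_coequalizer C f g q \<longleftrightarrow> q \<cdot> f = q \<cdot> g \<and>
    (\<forall>W. \<forall>h \<in> hom C Y W. h \<cdot> f = h \<cdot> g \<longrightarrow> (\<exists>!k. k \<in> hom C Q W \<and> k \<cdot> q = h))"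
  using assms homD(1,2,3)[OF assms(1)] homD(3)[OF assms(3)] unfolding is_coequalizer_def by simp

lemma is_pullback_iff:
  assumes "f \<in> hom C X B" "g \<in> hom C Y B" "p \<in> hom C P X" "q \<in> hom C P Y"
  shows "is_pullback C f g p q \<longleftrightarrow> f \<cdot> p = g \<cdot> q \<and>
     (\<forall>W. \<forall>u \<in> hom C W X. \<forall>v \<in> hom C W Y. f \<cdot> u = g \<cdot> v \<longrightarrow>
        (\<exists>!h. h \<in> hom C W P \<and> p \<cdot> h = u \<and> q \<cdot> h = v))"
  using assms homD(1,2,3)[OF assms(1)] homD(1,2,3)[OF assms(2)] homD(2)[OF assms(3)]
  unfolding is_pullback_def by simp

lemma is_pullback_homD:
  assumes "is_pullback C f g p q" "f \<in> hom C X B" "g \<in> hom C Y B"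
  shows "p \<in> hom C (Dom C p) X" "q \<in> hom C (Dom C p) Y"
  using assms(1) homD(2)[OF assms(2)] homD(2)[OF assms(3)] unfolding is_pullback_def by simp_all

lemma is_kernel_iff:
  assumes "f \<in> hom C X Y" "k \<in> hom C K X"
  shows "is_kernel C f k \<longleftrightarrow> f \<cdot> k = zero_arrow C K Y \<and>
     (\<forall>W. \<forall>u \<in> hom C W X. f \<cdot> u = zero_arrow C W Y \<longrightarrow> (\<exists>!h. h \<in> hom C W K \<and> k \<cdot> h = u))"
  using assms homD(1,2,3)[OF assms(1)] homD(2)[OF assms(2)] unfolding is_kernel_def by simp

lemma mono_arrow_iff:
  assumes "f \<in> hom C X Y"
  shows "mono_arrow C f \<longleftrightarrow>
    (\<forall>W. \<forall>g \<in> hom C W X. \<forall>h \<in> hom C W X. f \<cdot> g = f \<cdot> h \<longrightarrow> g = h)"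
  using homD(1,2)[OF assms] unfolding mono_arrow_def by simp

lemma mono_arrowD:
  assumes "mono_arrow C f" "f \<in> hom C X Y" "g \<in> hom C W X" "h \<in> hom C W X" "f \<cdot> g = f \<cdot> h"
  shows "g = h"
  using assms mono_arrow_iff[OF assms(2)] by blast

text \<open>Arrows identified by \<open>q\<close> have equal composites with
  \<open>f \<cdot> p\<close>; cancelling \<open>f\<close> shows that \<open>p\<close> identifies
  them too, and arrows into a pullback are determined by both projections.\<close>

lemma pullback_mono:
  assumes pb: "is_pullback C f g p q" and f: "f \<in> hom C X B" and g: "g \<in> hom C Y B"
    and mono: "mono_arrow C f"
  shows "mono_arrow C q"
proof -
  note p = is_pullback_homD(1)[OF pb f g] and q = is_pullback_homD(2)[OF pb f g]
  note pb' = pb[unfolded is_pullback_iff[OF f g p q]]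
  show ?thesis
    unfolding mono_arrow_iff[OF q]
  proof (intro allI ballI impI)
    fix W u v
    assume u: "u \<in> hom C W (Dom C p)" and v: "v \<in> hom C W (Dom C p)" and e: "q \<cdot> u = q \<cdot> v"
    have sq: "f \<cdot> (p \<cdot> w) = g \<cdot> (q \<cdot> w)" if "w \<in> hom C W (Dom C p)" for w
      using Comp_assoc[OF that p f] Comp_assoc[OF that q g] pb' by simp
    have "p \<cdot> u = p \<cdot> v"
      using mono_arrowD[OF mono f Comp_in_hom[OF u p] Comp_in_hom[OF v p]] sq[OF u] sq[OF v] e by simp
    moreover have "\<exists>!h. h \<in> hom C W (Dom C p) \<and> p \<cdot> h = p \<cdot> u \<and> q \<cdot> h = q \<cdot> u"
      using pb' Comp_in_hom[OF u p] Comp_in_hom[OF u q] sq[OF u] by blast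
    ultimately show "u = v" using u v e by metis
  qed
qed

text \<open>By symmetry of the square. \<open>is_pullback\<close> reads the apex off its first
  projection, so transposing the square replaces \<open>Dom C p\<close> by
  \<open>Dom C q\<close>.\<close>

lemma pullback_of_mono_mono:
  assumes pb: "is_pullback C f g p q" and f: "f \<in> hom C X B" and g: "g \<in> hom C Y B"
    and mono: "mono_arrow C g"
  shows "mono_arrow C p"
proof -
  note p = is_pullback_homD(1)[OF pb f g] and q = is_pullback_homD(2)[OF pb f g]
  have "\<exists>!h. h \<in> hom C W (Dom C q) \<and> q \<cdot> h = u \<and> p \<cdot> h = v"
    if "u \<in> hom C W Y" "v \<in> hom C W X" "g \<cdot> u = f \<cdot> v" for W u v
  proof -
    have "\<exists>!h. h \<in> hom C W (Dom C p) \<and> p \<cdot> h = v \<and> q \<cdot> h = u"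
      using pb[unfolded is_pullback_iff[OF f g p q]] that by simp
    then show ?thesis using homD(2)[OF q] by metis
  qed
  then have "is_pullback C g f q p"
    using is_pullback_iff[OF g f q p] pb[unfolded is_pullback_iff[OF f g p q]] homD(2)[OF q] by simp
  then show ?thesis using pullback_mono[OF _ g f mono] by blast
qed

text \<open>A regular epimorphism that factors through a monomorphism forces the latter to be
  invertible: cancelling \<open>m\<close> shows that \<open>t\<close> coequalizes the pair defining
  \<open>q\<close>, hence \<open>t = u \<cdot> q\<close>. Uniqueness of factorizations through
  \<open>q\<close> makes \<open>u\<close> a right inverse of \<open>m\<close>, and cancelling
  \<open>m\<close> once more makes it a left inverse.\<close>

lemma mono_regular_epi_factor_iso:
  assumes m: "m \<in> hom C X Y" "mono_arrow C m" and q: "regular_epi C q" "q \<in> hom C P Y"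
    and t: "t \<in> hom C P X" "m \<cdot> t = q"
  obtains u where "u \<in> hom C Y X" "m \<cdot> u = Ide C Y" "u \<cdot> m = Ide C X"
proof -
  obtain f g where co: "is_coequalizer C f g q" using q(1) unfolding regular_epi_def by blast
  define W where "W = Dom C f"
  have P: "Cod C f = P"
    using co homD(2)[OF q(2)] unfolding is_coequalizer_def hom_def by auto
  have f: "f \<in> hom C W P" and g: "g \<in> hom C W P"
    using co P unfolding is_coequalizer_def W_def by (auto simp: hom_def)
  note co' = co[unfolded is_coequalizer_iff[OF f g q(2)]]
  have "m \<cdot> (t \<cdot> f) = m \<cdot> (t \<cdot> g)"
    using Comp_assoc[OF f t(1) m(1)] Comp_assoc[OF g t(1) m(1)] t(2) co' by simp
  then have "t \<cdot> f = t \<cdot> g"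
    using mono_arrowD[OF m(2,1) Comp_in_hom[OF f t(1)] Comp_in_hom[OF g t(1)]] by simp
  then obtain u where u: "u \<in> hom C Y X" "u \<cdot> q = t" using co' t(1) by blast
  have "(m \<cdot> u) \<cdot> q = q" using Comp_assoc[OF q(2) u(1) m(1)] u t by simp
  moreover have "\<exists>!k. k \<in> hom C Y Y \<and> k \<cdot> q = q" using co' q(2) by blast
  ultimately have mu: "m \<cdot> u = Ide C Y"
    using Comp_in_hom[OF u(1) m(1)] Ide_in_hom[OF homD(5)[OF q(2)]] Ide_left[OF q(2)] by metis
  have "m \<cdot> (u \<cdot> m) = m \<cdot> Ide C X"
    using Comp_assoc[OF m(1) u(1) m(1)] mu Ide_left[OF m(1)] Ide_right[OF m(1)] by simp
  then have "u \<cdot> m = Ide C X"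
    using mono_arrowD[OF m(2,1) Comp_in_hom[OF m(1) u(1)] Ide_in_hom[OF homD(4)[OF m(1)]]] by simp
  then show ?thesis using that u(1) mu by blast
qed

end

section \<open>Cosmash products in homological categories\<close>

locale cocomplete_homological = category +
  assumes homological: "homological C"
    and cocomplete: "finitely_cocomplete C"
begin

lemma complete: "finitely_complete C" and regular: "regular C" and protomodular: "protomodular C"
  using homological unfolding homological_def by auto

lemma obtain_zero:
  obtains Z where "zero_object C Z"
  using homological unfolding homological_def pointed_def by blast

section \<open>Zero arrows, kernels and split extensions\<close>

lemma zero_objectD:
  assumes "zero_object C Z" "X \<in> Obj C"
  shows "\<exists>f. f \<in> hom C X Z" "\<exists>f. f \<in> hom C Z X"
    "f \<in> hom C X Z \<Longrightarrow> f' \<in> hom C X Z \<Longrightarrow> f = f'"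
    "g \<in> hom C Z X \<Longrightarrow> g' \<in> hom C Z X \<Longrightarrow> g = g'"
  using assms unfolding zero_object_def by blast+

text \<open>The description defining \<open>zero_arrow\<close> ranges over all zero objects. It is
  well defined because the comparison arrow \<open>z\<close> between two zero objects carries one
  factorization to the other.\<close>

lemma zero_arrow_eq:
  assumes Z: "zero_object C Z" and g: "g \<in> hom C X Z" and h: "h \<in> hom C Z Y"
  shows "zero_arrow C X Y = h \<cdot> g"
  unfolding zero_arrow_def
proof (rule the_equality)
  show "\<exists>Z. zero_object C Z \<and> (\<exists>g'\<in>hom C X Z. \<exists>h'\<in>hom C Z Y. h \<cdot> g = h' \<cdot> g')"
    using assms by blast
next
  fix f
  assume "\<exists>Z. zero_object C Z \<and> (\<exists>g\<in>hom C X Z. \<exists>h\<in>hom C Z Y. f = h \<cdot> g)"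
  then obtain Z' g' h' where Z': "zero_object C Z'" and g': "g' \<in> hom C X Z'"
    and h': "h' \<in> hom C Z' Y" and f: "f = h' \<cdot> g'" by blast
  obtain z where z: "z \<in> hom C Z Z'" using zero_objectD(1)[OF Z' homD(5)[OF g]] by blast
  have "z \<cdot> g = g'" by (rule zero_objectD(3)[OF Z' homD(4)[OF g] Comp_in_hom[OF g z] g'])
  moreover have "h' \<cdot> z = h" by (rule zero_objectD(4)[OF Z homD(5)[OF h] Comp_in_hom[OF z h'] h])
  ultimately show "f = h \<cdot> g" using f Comp_assoc[OF g z h'] by simp
qed

lemma zero_in_hom:
  assumes "X \<in> Obj C" "Y \<in> Obj C"
  shows "zero_arrow C X Y \<in> hom C X Y"
proof -
  obtain Z where Z: "zero_object C Z" by (rule obtain_zero)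
  obtain g h where g: "g \<in> hom C X Z" and h: "h \<in> hom C Z Y"
    using zero_objectD(1)[OF Z assms(1)] zero_objectD(2)[OF Z assms(2)] by blast
  show ?thesis using zero_arrow_eq[OF Z g h] Comp_in_hom[OF g h] by simp
qed

lemma comp_zero:
  assumes f: "f \<in> hom C Y W" and X: "X \<in> Obj C"
  shows "f \<cdot> zero_arrow C X Y = zero_arrow C X W"
proof -
  obtain Z where Z: "zero_object C Z" by (rule obtain_zero)
  obtain g h where g: "g \<in> hom C X Z" and h: "h \<in> hom C Z Y"
    using zero_objectD(1)[OF Z X] zero_objectD(2)[OF Z homD(4)[OF f]] by blast
  show ?thesis
    using zero_arrow_eq[OF Z g h] zero_arrow_eq[OF Z g Comp_in_hom[OF h f]] Comp_assoc[OF g h f]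
    by simp
qed

lemma zero_comp:
  assumes f: "f \<in> hom C W X" and Y: "Y \<in> Obj C"
  shows "zero_arrow C X Y \<cdot> f = zero_arrow C W Y"
proof -
  obtain Z where Z: "zero_object C Z" by (rule obtain_zero)
  obtain g h where g: "g \<in> hom C X Z" and h: "h \<in> hom C Z Y"
    using zero_objectD(1)[OF Z homD(5)[OF f]] zero_objectD(2)[OF Z Y] by blast
  show ?thesis
    using zero_arrow_eq[OF Z g h] zero_arrow_eq[OF Z Comp_in_hom[OF f g] h] Comp_assoc[OF f g h]
    by simp
qed

lemma kernel_mono:
  assumes k: "is_kernel C f k" and f: "f \<in> hom C X Y" and kh: "k \<in> hom C K X"
  shows "mono_arrow C k"
  unfolding mono_arrow_iff[OF kh]
proof (intro allI ballI impI)
  fix W g h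
  assume g: "g \<in> hom C W K" and h: "h \<in> hom C W K" and e: "k \<cdot> g = k \<cdot> h"
  have "f \<cdot> (k \<cdot> g) = zero_arrow C W Y"
    using Comp_assoc[OF g kh f] k zero_comp[OF g homD(5)[OF f]] unfolding is_kernel_iff[OF f kh] by simp
  then have "\<exists>!j. j \<in> hom C W K \<and> k \<cdot> j = k \<cdot> g"
    using k Comp_in_hom[OF g kh] unfolding is_kernel_iff[OF f kh] by blast
  then show "g = h" using g h e by metis
qed

text \<open>A kernel is a pullback along the arrow from a zero object: the component of a test pair
  that lands in \<open>Z\<close> exists and is unique, so it carries no data. This links kernels
  both to the existence of pullbacks and to protomodularity, which is phrased with
  pullbacks.\<close>

lemma kernel_iff_pullback:
  assumes f: "f \<in> hom C X Y" and k: "k \<in> hom C K X" and Z: "zero_object C Z"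
    and z: "z \<in> hom C Z Y" and r: "r \<in> hom C K Z"
  shows "is_kernel C f k \<longleftrightarrow> is_pullback C f z k r"
proof -
  have zero: "zero_arrow C W Y = z \<cdot> v" if "v \<in> hom C W Z" for W v
    by (rule zero_arrow_eq[OF Z that z])
  have ex1: "(\<exists>!h. h \<in> hom C W K \<and> k \<cdot> h = u) \<longleftrightarrow>
      (\<exists>!h. h \<in> hom C W K \<and> k \<cdot> h = u \<and> r \<cdot> h = v)" if "v \<in> hom C W Z" for W u v
    using zero_objectD(3)[OF Z homD(4)[OF that] that] Comp_in_hom[OF _ r] by metis
  have ex: "\<exists>v. v \<in> hom C W Z" if "u \<in> hom C W X" for W u
    using zero_objectD(1)[OF Z homD(4)[OF that]] .
  have "(f \<cdot> u = zero_arrow C W Y \<longrightarrow> (\<exists>!h. h \<in> hom C W K \<and> k \<cdot> h = u)) \<longleftrightarrow>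
      (\<forall>v \<in> hom C W Z. f \<cdot> u = z \<cdot> v \<longrightarrow> (\<exists>!h. h \<in> hom C W K \<and> k \<cdot> h = u \<and> r \<cdot> h = v))"
    if u: "u \<in> hom C W X" for W u
  proof -
    obtain v where v: "v \<in> hom C W Z" using ex[OF u] by blast
    have "v' = v" if "v' \<in> hom C W Z" for v'
      by (rule zero_objectD(3)[OF Z homD(4)[OF u] that v])
    then show ?thesis unfolding zero[OF v] ex1[OF v] using v by blast
  qed
  then show ?thesis
    unfolding is_kernel_iff[OF f k] is_pullback_iff[OF f z k r] zero[OF r] by blast
qed

lemma ex_kernel:
  assumes f: "f \<in> hom C X Y"
  obtains k where "is_kernel C f k" "k \<in> hom C (Dom C k) X"
proof -
  obtain Z where Z: "zero_object C Z" by (rule obtain_zero)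
  obtain z where z: "z \<in> hom C Z Y" using zero_objectD(2)[OF Z homD(5)[OF f]] by blast
  obtain k r where pb: "is_pullback C f z k r" using ex_pullback[OF complete f z] by blast
  note k = is_pullback_homD(1)[OF pb f z] and r = is_pullback_homD(2)[OF pb f z]
  show ?thesis using that k kernel_iff_pullback[OF f k Z z r] pb by blast
qed

lemma kernel_factor:
  assumes "is_kernel C f k" "f \<in> hom C X Y" "k \<in> hom C K X" "u \<in> hom C W X"
    "f \<cdot> u = zero_arrow C W Y"
  obtains h where "h \<in> hom C W K" "k \<cdot> h = u"
  using assms is_kernel_iff[OF assms(2,3)] by blast

text \<open>Over a zero object every square commutes, so the pullback there is a product.\<close>

lemma ex_product:
  assumes X: "X \<in> Obj C" and Y: "Y \<in> Obj C"
  obtains p q where "is_product C X Y p q"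
proof -
  obtain Z where Z: "zero_object C Z" by (rule obtain_zero)
  obtain f g where f: "f \<in> hom C X Z" and g: "g \<in> hom C Y Z"
    using zero_objectD(1)[OF Z] X Y by blast
  obtain p q where pb: "is_pullback C f g p q" using ex_pullback[OF complete f g] by blast
  note p = is_pullback_homD(1)[OF pb f g] and q = is_pullback_homD(2)[OF pb f g]
  have "f \<cdot> u = g \<cdot> v" if "u \<in> hom C W X" "v \<in> hom C W Y" for W u v
    by (rule zero_objectD(3)[OF Z homD(4)[OF that(1)] Comp_in_hom[OF that(1) f]
          Comp_in_hom[OF that(2) g]])
  then have "is_product C X Y p q"
    using pb[unfolded is_pullback_iff[OF f g p q]] p q unfolding is_product_def by simp
  then show ?thesis by (rule that)
qed

text \<open>The inclusion \<open>m\<close> is a morphism of points over \<open>B\<close> that induces an identity on kernels,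
  that is, on pullbacks along \<open>0 \<rightarrow> B\<close>.\<close>

lemma split_extension_generated:
  assumes p: "p \<in> hom C X B" and s: "s \<in> hom C B X" and ps: "p \<cdot> s = Ide C B"
    and ker: "is_kernel C p k" and k: "k \<in> hom C K X"
    and m: "m \<in> hom C S X" and mono: "mono_arrow C m"
    and k': "k' \<in> hom C K S" "m \<cdot> k' = k" and s': "s' \<in> hom C B S" "m \<cdot> s' = s"
  shows "iso_arrow C m"
proof -
  obtain Z where Z: "zero_object C Z" by (rule obtain_zero)
  obtain z where z: "z \<in> hom C Z B" using zero_objectD(2)[OF Z homD(5)[OF p]] by blast
  obtain r where r: "r \<in> hom C K Z" using zero_objectD(1)[OF Z homD(4)[OF k]] by blast
  have pm: "p \<cdot> m \<in> hom C S B" by (rule Comp_in_hom[OF m p])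
  have pms: "(p \<cdot> m) \<cdot> s' = Ide C B" using Comp_assoc[OF s'(1) m p] s' ps by simp
  \<comment> \<open>Since \<open>m\<close> is monic, factoring \<open>u\<close> through
    \<open>k'\<close> is the same as factoring \<open>m \<cdot> u\<close> through \<open>k\<close>.
    Both points thus have the same kernel object \<open>K\<close>, and the arrow induced between
    their pullbacks is \<open>Ide C K\<close>.\<close>
  have ker': "is_kernel C (p \<cdot> m) k'"
    unfolding is_kernel_iff[OF pm k'(1)]
  proof (intro conjI allI ballI impI)
    show "(p \<cdot> m) \<cdot> k' = zero_arrow C K B"
      using Comp_assoc[OF k'(1) m p] k' ker unfolding is_kernel_iff[OF p k] by simp
  next
    fix W u
    assume u: "u \<in> hom C W S" and "(p \<cdot> m) \<cdot> u = zero_arrow C W B"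
    then have "p \<cdot> (m \<cdot> u) = zero_arrow C W B" using Comp_assoc[OF u m p] by simp
    then have ex1: "\<exists>!h. h \<in> hom C W K \<and> k \<cdot> h = m \<cdot> u"
      using ker Comp_in_hom[OF u m] unfolding is_kernel_iff[OF p k] by blast
    have "k \<cdot> h = m \<cdot> u \<longleftrightarrow> k' \<cdot> h = u" if h: "h \<in> hom C W K" for h
      using mono_arrowD[OF mono m Comp_in_hom[OF h k'(1)] u] Comp_assoc[OF h k'(1) m] k'(2) by auto
    then show "\<exists>!h. h \<in> hom C W K \<and> k' \<cdot> h = u" using ex1 by metis
  qed
  have idK: "Ide C K \<in> hom C K K" by (rule Ide_in_hom[OF homD(4)[OF k]])
  have "is_point C (p \<cdot> m) s'" "is_point C p s"
    using pm s' pms p s ps homD[OF pm] homD[OF p] by (auto simp: is_point_def)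
  moreover have "is_pullback C (p \<cdot> m) z k' r"
    using ker' kernel_iff_pullback[OF pm k'(1) Z z r] by simp
  moreover have "is_pullback C p z k r" using ker kernel_iff_pullback[OF p k Z z r] by simp
  moreover have "k \<cdot> Ide C K = m \<cdot> k'" "r \<cdot> Ide C K = r"
    using Ide_right[OF k] Ide_right[OF r] k' by simp_all
  moreover have "iso_arrow C (Ide C K)"
    using idK Ide_left[OF idK] homD[OF idK] unfolding iso_arrow_def by auto
  ultimately show ?thesis
    using protomodular[unfolded protomodular_def, rule_format, of "p \<cdot> m" s' p s m z k' r k r "Ide C K"]
      homD(2,3)[OF pm] homD(2,3)[OF p] homD(2)[OF r] m s' idK by simp
qed

section \<open>Chosen products and coproducts\<close>

lemma product_facts:
  assumes X: "X \<in> Obj C" and Y: "Y \<in> Obj C"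
  shows "proj1 C X Y \<in> hom C (product C X Y) X" "proj2 C X Y \<in> hom C (product C X Y) Y"
    and "f \<in> hom C W X \<Longrightarrow> g \<in> hom C W Y \<Longrightarrow>
      \<exists>!h. h \<in> hom C W (product C X Y) \<and> proj1 C X Y \<cdot> h = f \<and> proj2 C X Y \<cdot> h = g"
proof -
  have "\<exists>pq. case pq of (p, q) \<Rightarrow> is_product C X Y p q" using ex_product[OF X Y] by (metis case_prodI)
  then have "case product_cone C X Y of (p, q) \<Rightarrow> is_product C X Y p q"
    unfolding product_cone_def by (rule someI_ex)
  then have "is_product C X Y (proj1 C X Y) (proj2 C X Y)"
    by (simp add: proj1_def proj2_def case_prod_beta)
  then show "proj1 C X Y \<in> hom C (product C X Y) X" "proj2 C X Y \<in> hom C (product C X Y) Y"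
    "f \<in> hom C W X \<Longrightarrow> g \<in> hom C W Y \<Longrightarrow>
      \<exists>!h. h \<in> hom C W (product C X Y) \<and> proj1 C X Y \<cdot> h = f \<and> proj2 C X Y \<cdot> h = g"
    unfolding is_product_def product_def by blast+
qed

lemma pairing:
  assumes f: "f \<in> hom C W X" and g: "g \<in> hom C W Y"
  shows "pairing C f g \<in> hom C W (product C X Y)"
    "proj1 C X Y \<cdot> pairing C f g = f" "proj2 C X Y \<cdot> pairing C f g = g"
  using theI'[OF product_facts(3)[OF homD(5)[OF f] homD(5)[OF g] f g]]
  unfolding pairing_def homD(2,3)[OF f] homD(3)[OF g] by auto

lemma product_ext:
  assumes "u \<in> hom C W (product C X Y)" "v \<in> hom C W (product C X Y)" "X \<in> Obj C" "Y \<in> Obj C"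
    "proj1 C X Y \<cdot> u = proj1 C X Y \<cdot> v" "proj2 C X Y \<cdot> u = proj2 C X Y \<cdot> v"
  shows "u = v"
  using product_facts(3)[OF assms(3,4) Comp_in_hom[OF assms(1) product_facts(1)[OF assms(3,4)]]
      Comp_in_hom[OF assms(1) product_facts(2)[OF assms(3,4)]]] assms by metis

lemma coproduct_facts:
  assumes X: "X \<in> Obj C" and Y: "Y \<in> Obj C"
  shows "inj1 C X Y \<in> hom C X (coproduct C X Y)" "inj2 C X Y \<in> hom C Y (coproduct C X Y)"
    and "f \<in> hom C X W \<Longrightarrow> g \<in> hom C Y W \<Longrightarrow>
      \<exists>!h. h \<in> hom C (coproduct C X Y) W \<and> h \<cdot> inj1 C X Y = f \<and> h \<cdot> inj2 C X Y = g"
proof -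
  have "\<exists>ij. case ij of (i, j) \<Rightarrow> is_coproduct C X Y i j"
    using ex_coproduct[OF cocomplete X Y] by (metis case_prodI)
  then have "case coproduct_cocone C X Y of (i, j) \<Rightarrow> is_coproduct C X Y i j"
    unfolding coproduct_cocone_def by (rule someI_ex)
  then have "is_coproduct C X Y (inj1 C X Y) (inj2 C X Y)"
    by (simp add: inj1_def inj2_def case_prod_beta)
  then show "inj1 C X Y \<in> hom C X (coproduct C X Y)" "inj2 C X Y \<in> hom C Y (coproduct C X Y)"
    "f \<in> hom C X W \<Longrightarrow> g \<in> hom C Y W \<Longrightarrow>
      \<exists>!h. h \<in> hom C (coproduct C X Y) W \<and> h \<cdot> inj1 C X Y = f \<and> h \<cdot> inj2 C X Y = g"
    unfolding is_coproduct_def coproduct_def by blast+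
qed

lemma copairing:
  assumes f: "f \<in> hom C X W" and g: "g \<in> hom C Y W"
  shows "copairing C f g \<in> hom C (coproduct C X Y) W"
    "copairing C f g \<cdot> inj1 C X Y = f" "copairing C f g \<cdot> inj2 C X Y = g"
  using theI'[OF coproduct_facts(3)[OF homD(4)[OF f] homD(4)[OF g] f g]]
  unfolding copairing_def homD(2,3)[OF f] homD(2)[OF g] by auto

lemma coproduct_ext:
  assumes "u \<in> hom C (coproduct C X Y) W" "v \<in> hom C (coproduct C X Y) W" "X \<in> Obj C" "Y \<in> Obj C"
    "u \<cdot> inj1 C X Y = v \<cdot> inj1 C X Y" "u \<cdot> inj2 C X Y = v \<cdot> inj2 C X Y"
  shows "u = v"
  using coproduct_facts(3)[OF assms(3,4) Comp_in_hom[OF coproduct_facts(1)[OF assms(3,4)] assms(1)]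
      Comp_in_hom[OF coproduct_facts(2)[OF assms(3,4)] assms(1)]] assms by metis

section \<open>The retractions of a sum and their common kernel\<close>

lemma retr1:
  assumes "X \<in> Obj C" "Y \<in> Obj C"
  shows "retr1 C X Y \<in> hom C (coproduct C X Y) X"
    "retr1 C X Y \<cdot> inj1 C X Y = Ide C X" "retr1 C X Y \<cdot> inj2 C X Y = zero_arrow C Y X"
  unfolding retr1_def using copairing[OF Ide_in_hom zero_in_hom] assms by auto

lemma retr2:
  assumes "X \<in> Obj C" "Y \<in> Obj C"
  shows "retr2 C X Y \<in> hom C (coproduct C X Y) Y"
    "retr2 C X Y \<cdot> inj1 C X Y = zero_arrow C X Y" "retr2 C X Y \<cdot> inj2 C X Y = Ide C Y"
  unfolding retr2_def using copairing[OF zero_in_hom Ide_in_hom] assms by auto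

lemma sum_to_prod:
  assumes "X \<in> Obj C" "Y \<in> Obj C"
  shows "sum_to_prod C X Y \<in> hom C (coproduct C X Y) (product C X Y)"
    "proj1 C X Y \<cdot> sum_to_prod C X Y = retr1 C X Y"
    "proj2 C X Y \<cdot> sum_to_prod C X Y = retr2 C X Y"
  unfolding sum_to_prod_def using pairing[OF retr1(1) retr2(1)] assms by auto

text \<open>Vanishing in a product is tested on the projections, and these turn
  \<open>sum_to_prod\<close> into the two retractions. Hence \<open>cosmash_incl\<close> is the
  universal arrow annihilated by both retractions.\<close>

lemma sum_to_prod_comp_eq_zero_iff:
  assumes X: "X \<in> Obj C" and Y: "Y \<in> Obj C" and u: "u \<in> hom C W (coproduct C X Y)"
  shows "sum_to_prod C X Y \<cdot> u = zero_arrow C W (product C X Y) \<longleftrightarrow>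
    retr1 C X Y \<cdot> u = zero_arrow C W X \<and> retr2 C X Y \<cdot> u = zero_arrow C W Y"
proof -
  note b = sum_to_prod(1)[OF X Y] and p = product_facts(1)[OF X Y] and q = product_facts(2)[OF X Y]
  have W: "W \<in> Obj C" and P: "product C X Y \<in> Obj C" using homD(4)[OF u] homD(4)[OF p] .
  have "proj1 C X Y \<cdot> (sum_to_prod C X Y \<cdot> u) = retr1 C X Y \<cdot> u"
    "proj2 C X Y \<cdot> (sum_to_prod C X Y \<cdot> u) = retr2 C X Y \<cdot> u"
    using Comp_assoc[OF u b p] Comp_assoc[OF u b q] sum_to_prod[OF X Y] by simp_all
  then show ?thesis
    using product_ext[OF Comp_in_hom[OF u b] zero_in_hom[OF W P] X Y] comp_zero[OF p W] comp_zero[OF q W]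
    by auto
qed

lemma cosmash_incl:
  assumes X: "X \<in> Obj C" and Y: "Y \<in> Obj C"
  shows "is_kernel C (sum_to_prod C X Y) (cosmash_incl C X Y)"
    "cosmash_incl C X Y \<in> hom C (cosmash C X Y) (coproduct C X Y)"
    "retr1 C X Y \<cdot> cosmash_incl C X Y = zero_arrow C (cosmash C X Y) X"
    "retr2 C X Y \<cdot> cosmash_incl C X Y = zero_arrow C (cosmash C X Y) Y"
proof -
  note b = sum_to_prod(1)[OF X Y]
  have "\<exists>k. is_kernel C (sum_to_prod C X Y) k" using ex_kernel[OF b] by blast
  then show ker: "is_kernel C (sum_to_prod C X Y) (cosmash_incl C X Y)"
    unfolding cosmash_incl_def by (rule someI_ex)
  then show k: "cosmash_incl C X Y \<in> hom C (cosmash C X Y) (coproduct C X Y)"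
    using homD(2)[OF b] unfolding is_kernel_def cosmash_def by simp
  show "retr1 C X Y \<cdot> cosmash_incl C X Y = zero_arrow C (cosmash C X Y) X"
    "retr2 C X Y \<cdot> cosmash_incl C X Y = zero_arrow C (cosmash C X Y) Y"
    using ker sum_to_prod_comp_eq_zero_iff[OF X Y k] unfolding is_kernel_iff[OF b k] by auto
qed

lemma cosmash_incl_mono:
  assumes "X \<in> Obj C" "Y \<in> Obj C"
  shows "mono_arrow C (cosmash_incl C X Y)"
  by (rule kernel_mono[OF cosmash_incl(1) sum_to_prod(1) cosmash_incl(2)]) (use assms in auto)

lemma cosmash_factor:
  assumes X: "X \<in> Obj C" and Y: "Y \<in> Obj C" and u: "u \<in> hom C W (coproduct C X Y)"
    and "retr1 C X Y \<cdot> u = zero_arrow C W X" "retr2 C X Y \<cdot> u = zero_arrow C W Y"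
  obtains h where "h \<in> hom C W (cosmash C X Y)" "cosmash_incl C X Y \<cdot> h = u"
  using kernel_factor[OF cosmash_incl(1)[OF X Y] sum_to_prod(1)[OF X Y] cosmash_incl(2)[OF X Y] u]
    sum_to_prod_comp_eq_zero_iff[OF X Y u] assms(4,5) by blast

section \<open>Functoriality of sums and cosmash products\<close>

lemma coproduct_map:
  assumes a: "a \<in> hom C X X'" and g: "g \<in> hom C Y Y'"
  shows "coproduct_map C a g \<in> hom C (coproduct C X Y) (coproduct C X' Y')"
    "coproduct_map C a g \<cdot> inj1 C X Y = inj1 C X' Y' \<cdot> a"
    "coproduct_map C a g \<cdot> inj2 C X Y = inj2 C X' Y' \<cdot> g"
proof -
  have X': "X' \<in> Obj C" and Y': "Y' \<in> Obj C" using homD(5) a g by blast+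
  show "coproduct_map C a g \<in> hom C (coproduct C X Y) (coproduct C X' Y')"
    "coproduct_map C a g \<cdot> inj1 C X Y = inj1 C X' Y' \<cdot> a"
    "coproduct_map C a g \<cdot> inj2 C X Y = inj2 C X' Y' \<cdot> g"
    using copairing[OF Comp_in_hom[OF a coproduct_facts(1)[OF X' Y']]
        Comp_in_hom[OF g coproduct_facts(2)[OF X' Y']]]
    unfolding coproduct_map_def homD(3)[OF a] homD(3)[OF g] by auto
qed

text \<open>These equations evaluate composites with \<open>coproduct_map\<close> on the injections,
  where \<open>coproduct_ext\<close> compares arrows.\<close>

lemma comp_coproduct_map:
  assumes a: "a \<in> hom C X X'" and g: "g \<in> hom C Y Y'" and f: "f \<in> hom C (coproduct C X' Y') W"
  shows "f \<cdot> coproduct_map C a g \<in> hom C (coproduct C X Y) W"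
    "(f \<cdot> coproduct_map C a g) \<cdot> inj1 C X Y = (f \<cdot> inj1 C X' Y') \<cdot> a"
    "(f \<cdot> coproduct_map C a g) \<cdot> inj2 C X Y = (f \<cdot> inj2 C X' Y') \<cdot> g"
proof -
  note X = homD(4)[OF a] and X' = homD(5)[OF a] and Y = homD(4)[OF g] and Y' = homD(5)[OF g]
  note m = coproduct_map[OF a g]
  show "f \<cdot> coproduct_map C a g \<in> hom C (coproduct C X Y) W" by (rule Comp_in_hom[OF m(1) f])
  show "(f \<cdot> coproduct_map C a g) \<cdot> inj1 C X Y = (f \<cdot> inj1 C X' Y') \<cdot> a"
    using Comp_assoc[OF coproduct_facts(1)[OF X Y] m(1) f] m(2)
      Comp_assoc[OF a coproduct_facts(1)[OF X' Y'] f] by simp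
  show "(f \<cdot> coproduct_map C a g) \<cdot> inj2 C X Y = (f \<cdot> inj2 C X' Y') \<cdot> g"
    using Comp_assoc[OF coproduct_facts(2)[OF X Y] m(1) f] m(3)
      Comp_assoc[OF g coproduct_facts(2)[OF X' Y'] f] by simp
qed

text \<open>Checked on the two injections: on the matching one both sides reduce to the given arrow,
  on the other one both are zero.\<close>

lemma retr_natural:
  assumes a: "a \<in> hom C X X'" and g: "g \<in> hom C Y Y'"
  shows "retr1 C X' Y' \<cdot> coproduct_map C a g = a \<cdot> retr1 C X Y"
    "retr2 C X' Y' \<cdot> coproduct_map C a g = g \<cdot> retr2 C X Y"
proof -
  note X = homD(4)[OF a] and X' = homD(5)[OF a] and Y = homD(4)[OF g] and Y' = homD(5)[OF g]
  note i = coproduct_facts(1)[OF X Y] and j = coproduct_facts(2)[OF X Y]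
  note r1 = retr1[OF X Y] and r2 = retr2[OF X Y] and r1' = retr1[OF X' Y'] and r2' = retr2[OF X' Y']
  note c1 = comp_coproduct_map[OF a g r1'(1)] and c2 = comp_coproduct_map[OF a g r2'(1)]
  show "retr1 C X' Y' \<cdot> coproduct_map C a g = a \<cdot> retr1 C X Y"
    by (rule coproduct_ext[OF c1(1) Comp_in_hom[OF r1(1) a] X Y])
      (simp_all add: c1(2,3) r1 r1' Comp_assoc[OF i r1(1) a] Comp_assoc[OF j r1(1) a]
        Ide_left[OF a] Ide_right[OF a] zero_comp[OF g X'] comp_zero[OF a Y])
  show "retr2 C X' Y' \<cdot> coproduct_map C a g = g \<cdot> retr2 C X Y"
    by (rule coproduct_ext[OF c2(1) Comp_in_hom[OF r2(1) g] X Y])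
      (simp_all add: c2(2,3) r2 r2' Comp_assoc[OF i r2(1) g] Comp_assoc[OF j r2(1) g]
        Ide_left[OF g] Ide_right[OF g] zero_comp[OF a Y'] comp_zero[OF g X])
qed

text \<open>Naturality of the retractions shows that both annihilate
  \<open>coproduct_map C a g \<cdot> cosmash_incl C X Y\<close>, so this arrow lifts to the cosmash
  product. The lift is unique because the inclusion is monic, which justifies the definite
  description.\<close>

lemma cosmash_map:
  assumes a: "a \<in> hom C X X'" and g: "g \<in> hom C Y Y'"
  shows "cosmash_map C a g \<in> hom C (cosmash C X Y) (cosmash C X' Y')"
    "cosmash_incl C X' Y' \<cdot> cosmash_map C a g = coproduct_map C a g \<cdot> cosmash_incl C X Y"
proof -
  note X = homD(4)[OF a] and X' = homD(5)[OF a] and Y = homD(4)[OF g] and Y' = homD(5)[OF g]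
  note m = coproduct_map(1)[OF a g] and k = cosmash_incl[OF X Y]
  note r1 = retr1[OF X Y] and r2 = retr2[OF X Y] and r1' = retr1[OF X' Y'] and r2' = retr2[OF X' Y']
  note K = homD(4)[OF k(2)]
  have u: "coproduct_map C a g \<cdot> cosmash_incl C X Y \<in> hom C (cosmash C X Y) (coproduct C X' Y')"
    by (rule Comp_in_hom[OF k(2) m])
  have z1: "retr1 C X' Y' \<cdot> (coproduct_map C a g \<cdot> cosmash_incl C X Y) = zero_arrow C (cosmash C X Y) X'"
    using Comp_assoc[OF k(2) m r1'(1)] Comp_assoc[OF k(2) r1(1) a] retr_natural[OF a g] k(3)
      comp_zero[OF a K] by simp
  have z2: "retr2 C X' Y' \<cdot> (coproduct_map C a g \<cdot> cosmash_incl C X Y) = zero_arrow C (cosmash C X Y) Y'"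
    using Comp_assoc[OF k(2) m r2'(1)] Comp_assoc[OF k(2) r2(1) g] retr_natural[OF a g] k(4)
      comp_zero[OF g K] by simp
  obtain h where h: "h \<in> hom C (cosmash C X Y) (cosmash C X' Y')"
    "cosmash_incl C X' Y' \<cdot> h = coproduct_map C a g \<cdot> cosmash_incl C X Y"
    using cosmash_factor[OF X' Y' u z1 z2] .
  have "\<exists>!h. h \<in> hom C (cosmash C X Y) (cosmash C X' Y') \<and>
      cosmash_incl C X' Y' \<cdot> h = coproduct_map C a g \<cdot> cosmash_incl C X Y"
  proof (rule ex1I[of _ h])
    fix h' assume "h' \<in> hom C (cosmash C X Y) (cosmash C X' Y') \<and>
      cosmash_incl C X' Y' \<cdot> h' = coproduct_map C a g \<cdot> cosmash_incl C X Y"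
    then show "h' = h"
      using mono_arrowD[OF cosmash_incl_mono[OF X' Y'] cosmash_incl(2)[OF X' Y'], of h' _ h] h by auto
  qed (use h in blast)
  from theI'[OF this] show "cosmash_map C a g \<in> hom C (cosmash C X Y) (cosmash C X' Y')"
    "cosmash_incl C X' Y' \<cdot> cosmash_map C a g = coproduct_map C a g \<cdot> cosmash_incl C X Y"
    unfolding cosmash_map_def homD(2,3)[OF a] homD(2,3)[OF g] by auto
qed

section \<open>Semidirect products\<close>

lemma act_q:
  assumes A: "A \<in> Obj C" and G: "G \<in> Obj C" and \<psi>: "\<psi> \<in> hom C (cosmash C A G) A"
  shows "is_coequalizer C (cosmash_incl C A G) (inj1 C A G \<cdot> \<psi>) (act_q C A G \<psi>)"
    "act_q C A G \<psi> \<in> hom C (coproduct C A G) (act_Q C A G \<psi>)"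
    "act_l C A G \<psi> \<in> hom C A (act_Q C A G \<psi>)"
    "act_s C A G \<psi> \<in> hom C G (act_Q C A G \<psi>)"
    "act_q C A G \<psi> \<cdot> cosmash_incl C A G = act_l C A G \<psi> \<cdot> \<psi>"
proof -
  note i = coproduct_facts(1)[OF A G] and k = cosmash_incl(2)[OF A G]
  have "\<exists>q. is_coequalizer C (cosmash_incl C A G) (inj1 C A G \<cdot> \<psi>) q"
    using ex_coequalizer[OF cocomplete k Comp_in_hom[OF \<psi> i]] by blast
  then show co: "is_coequalizer C (cosmash_incl C A G) (inj1 C A G \<cdot> \<psi>) (act_q C A G \<psi>)"
    unfolding act_q_def by (rule someI_ex)
  then show q: "act_q C A G \<psi> \<in> hom C (coproduct C A G) (act_Q C A G \<psi>)"
    unfolding is_coequalizer_def act_Q_def homD(3)[OF k] by blast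
  show "act_l C A G \<psi> \<in> hom C A (act_Q C A G \<psi>)" "act_s C A G \<psi> \<in> hom C G (act_Q C A G \<psi>)"
    unfolding act_l_def act_s_def
    using Comp_in_hom[OF i q] Comp_in_hom[OF coproduct_facts(2)[OF A G] q] .
  have "act_q C A G \<psi> \<cdot> cosmash_incl C A G = act_q C A G \<psi> \<cdot> (inj1 C A G \<cdot> \<psi>)"
    using co unfolding is_coequalizer_def by blast
  then show "act_q C A G \<psi> \<cdot> cosmash_incl C A G = act_l C A G \<psi> \<cdot> \<psi>"
    unfolding act_l_def using Comp_assoc[OF \<psi> i q] by simp
qed

text \<open>The retraction onto \<open>G\<close> descends to the coequalizer because it annihilates
  both arrows of the pair: the cosmash inclusion lies in its kernel, and so does the first
  injection.\<close>

lemma act_p: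
  assumes A: "A \<in> Obj C" and G: "G \<in> Obj C" and \<psi>: "\<psi> \<in> hom C (cosmash C A G) A"
  shows "act_p C A G \<psi> \<in> hom C (act_Q C A G \<psi>) G"
    "act_p C A G \<psi> \<cdot> act_q C A G \<psi> = retr2 C A G"
    "act_p C A G \<psi> \<cdot> act_l C A G \<psi> = zero_arrow C A G"
proof -
  note i = coproduct_facts(1)[OF A G] and k = cosmash_incl(2)[OF A G] and q = act_q(2)[OF A G \<psi>]
  note r = retr2[OF A G]
  have "retr2 C A G \<cdot> cosmash_incl C A G = retr2 C A G \<cdot> (inj1 C A G \<cdot> \<psi>)"
    using Comp_assoc[OF \<psi> i r(1)] r(2) zero_comp[OF \<psi> G] cosmash_incl(4)[OF A G] by simp
  then have "\<exists>!p. p \<in> hom C (act_Q C A G \<psi>) G \<and> p \<cdot> act_q C A G \<psi> = retr2 C A G"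
    using act_q(1)[OF A G \<psi>] r(1) unfolding is_coequalizer_iff[OF k Comp_in_hom[OF \<psi> i] q] by blast
  from theI'[OF this] show p: "act_p C A G \<psi> \<in> hom C (act_Q C A G \<psi>) G"
    and pq: "act_p C A G \<psi> \<cdot> act_q C A G \<psi> = retr2 C A G"
    unfolding act_p_def by auto
  show "act_p C A G \<psi> \<cdot> act_l C A G \<psi> = zero_arrow C A G"
    unfolding act_l_def using Comp_assoc[OF i q p] pq r(2) by simp
qed

lemma act_l_kernel:
  assumes "is_action C A G \<psi>"
  shows "is_kernel C (act_p C A G \<psi>) (act_l C A G \<psi>)"
proof -
  have A: "A \<in> Obj C" and G: "G \<in> Obj C" and \<psi>: "\<psi> \<in> hom C (cosmash C A G) A"
    and mono_l: "mono_arrow C (act_l C A G \<psi>)"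
    using assms unfolding is_action_def by auto
  define q l p Q \<iota> i where "q = act_q C A G \<psi>" and "l = act_l C A G \<psi>" and "p = act_p C A G \<psi>"
    and "Q = act_Q C A G \<psi>" and "\<iota> = cosmash_incl C A G" and "i = inj1 C A G"
  note defs = this
  note i = coproduct_facts(1)[OF A G, folded defs]
  note \<iota> = cosmash_incl[OF A G, folded defs]
  note q = act_q(1,2,5)[OF A G \<psi>, folded defs] and l = act_q(3)[OF A G \<psi>, folded defs]
  note p = act_p[OF A G \<psi>, folded defs]
  note r1 = retr1[OF A G, folded defs] and r2 = retr2[OF A G, folded defs]
  have qi: "q \<cdot> i = l" by (simp add: defs act_l_def)

  obtain k where ker: "is_kernel C p k" and k: "k \<in> hom C (Dom C k) Q" using ex_kernel[OF p(1)] .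
  define K where "K = Dom C k"
  note k = k[folded K_def]
  have mono_k: "mono_arrow C k" by (rule kernel_mono[OF ker p(1) k])
  have pk: "p \<cdot> k = zero_arrow C K G" using ker unfolding is_kernel_iff[OF p(1) k] by blast
  obtain m where m: "m \<in> hom C A K" "k \<cdot> m = l" using kernel_factor[OF ker p(1) k l p(3)] .
  have mono_m: "mono_arrow C m"
    unfolding mono_arrow_iff[OF m(1)]
  proof (intro allI ballI impI)
    fix W g h
    assume g: "g \<in> hom C W A" and h: "h \<in> hom C W A" and "m \<cdot> g = m \<cdot> h"
    then have "l \<cdot> g = l \<cdot> h" using Comp_assoc[OF g m(1) k] Comp_assoc[OF h m(1) k] m(2) by simp
    then show "g = h" using mono_arrowD[OF mono_l[folded defs] l g h] by simp
  qed

  \<comment> \<open>Via \<open>\<kappa>\<close>, the object \<open>P\<close> is the inverse image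
    under \<open>q\<close> of the kernel of \<open>p\<close>. As \<open>p \<cdot> q\<close> is
    \<open>retr2 C A G\<close>, this retraction annihilates \<open>\<kappa>\<close>.\<close>
  obtain \<kappa> q' where pb: "is_pullback C q k \<kappa> q'" using ex_pullback[OF complete q(2) k] .
  define P where "P = Dom C \<kappa>"
  note \<kappa> = is_pullback_homD(1)[OF pb q(2) k, folded P_def]
  note q' = is_pullback_homD(2)[OF pb q(2) k, folded P_def]
  note pb' = pb[unfolded is_pullback_iff[OF q(2) k \<kappa> q']]
  have "regular_epi C q" using q(1) unfolding regular_epi_def by blast
  then have epi: "regular_epi C q'" using regular pb unfolding regular_def by blast
  have mono_\<kappa>: "mono_arrow C \<kappa>" by (rule pullback_of_mono_mono[OF pb q(2) k mono_k])
  have r2\<kappa>: "retr2 C A G \<cdot> \<kappa> = zero_arrow C P G"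
    using Comp_assoc[OF \<kappa> q(2) p(1)] Comp_assoc[OF q' k p(1)] pb' p(2) pk zero_comp[OF q' G] by simp

  \<comment> \<open>The arrows \<open>i\<close> and \<open>\<iota>\<close> lift to
    \<open>\<eta>\<close> and \<open>\<iota>'\<close> with values in \<open>P\<close>; their images
    under \<open>q'\<close> are \<open>m\<close> and \<open>m \<cdot> \<psi>\<close>.\<close>
  have "q \<cdot> i = k \<cdot> m" using qi m(2) by simp
  then obtain \<eta> where \<eta>: "\<eta> \<in> hom C A P" "\<kappa> \<cdot> \<eta> = i" "q' \<cdot> \<eta> = m" using pb' i m(1) by blast
  have m\<psi>: "m \<cdot> \<psi> \<in> hom C (cosmash C A G) K" by (rule Comp_in_hom[OF \<psi> m(1)])
  have "q \<cdot> \<iota> = k \<cdot> (m \<cdot> \<psi>)" using q(3) Comp_assoc[OF \<psi> m(1) k] m(2) by simp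
  then obtain \<iota>' where \<iota>': "\<iota>' \<in> hom C (cosmash C A G) P" "\<kappa> \<cdot> \<iota>' = \<iota>" "q' \<cdot> \<iota>' = m \<cdot> \<psi>"
    using pb' \<iota>(2) m\<psi> by blast
  \<comment> \<open>The split extension is obtained by restricting the retraction onto
    \<open>A\<close> to \<open>P\<close>; \<open>\<eta>\<close> is its section.\<close>
  define e where "e = retr1 C A G \<cdot> \<kappa>"
  have e: "e \<in> hom C P A" unfolding e_def by (rule Comp_in_hom[OF \<kappa> r1(1)])
  have e\<eta>: "e \<cdot> \<eta> = Ide C A" unfolding e_def using Comp_assoc[OF \<eta>(1) \<kappa> r1(1)] \<eta>(2) r1(2) by simp
  have ker_e: "is_kernel C e \<iota>'"
    unfolding is_kernel_iff[OF e \<iota>'(1)]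
  proof (intro conjI allI ballI impI)
    show "e \<cdot> \<iota>' = zero_arrow C (cosmash C A G) A"
      unfolding e_def using Comp_assoc[OF \<iota>'(1) \<kappa> r1(1)] \<iota>'(2) \<iota>(3) by simp
  next
    fix W u
    assume u: "u \<in> hom C W P" and eu: "e \<cdot> u = zero_arrow C W A"
    \<comment> \<open>An arrow into \<open>P\<close> that is annihilated by \<open>e\<close> is
      annihilated, after \<open>\<kappa>\<close>, by both retractions. It therefore factors through
      the cosmash product.\<close>
    have 1: "retr1 C A G \<cdot> (\<kappa> \<cdot> u) = zero_arrow C W A"
      using eu Comp_assoc[OF u \<kappa> r1(1)] unfolding e_def by simp
    have 2: "retr2 C A G \<cdot> (\<kappa> \<cdot> u) = zero_arrow C W G"
      using r2\<kappa> Comp_assoc[OF u \<kappa> r2(1)] zero_comp[OF u G] by simp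
    obtain h where h: "h \<in> hom C W (cosmash C A G)" "\<iota> \<cdot> h = \<kappa> \<cdot> u"
      using cosmash_factor[OF A G Comp_in_hom[OF u \<kappa>] 1 2, folded defs] .
    have eq: "\<kappa> \<cdot> (\<iota>' \<cdot> h') = \<iota> \<cdot> h'" if "h' \<in> hom C W (cosmash C A G)" for h'
      using Comp_assoc[OF that \<iota>'(1) \<kappa>] \<iota>'(2) by simp
    show "\<exists>!h. h \<in> hom C W (cosmash C A G) \<and> \<iota>' \<cdot> h = u"
    proof (rule ex1I[of _ h])
      show "h \<in> hom C W (cosmash C A G) \<and> \<iota>' \<cdot> h = u"
        using mono_arrowD[OF mono_\<kappa> \<kappa> Comp_in_hom[OF h(1) \<iota>'(1)] u] eq[OF h(1)] h by simp
    next
      fix h' assume h': "h' \<in> hom C W (cosmash C A G) \<and> \<iota>' \<cdot> h' = u"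
      then show "h' = h"
        using mono_arrowD[OF cosmash_incl_mono[OF A G, folded defs] \<iota>(2), of h' W h] eq[of h'] h by simp
    qed
  qed

  \<comment> \<open>\<open>S\<close> is the inverse image of the subobject \<open>m\<close> under
    \<open>q'\<close>. It contains the kernel \<open>\<iota>'\<close> and the section
    \<open>\<eta>\<close>, since their images under \<open>q'\<close> factor through
    \<open>m\<close>, by \<open>\<psi>\<close> and by the identity; protomodularity then makes
    \<open>n\<close> invertible.\<close>
  obtain a n where pbS: "is_pullback C m q' a n" using ex_pullback[OF complete m(1) q'] .
  define S where "S = Dom C a"
  note a = is_pullback_homD(1)[OF pbS m(1) q', folded S_def]
  note n = is_pullback_homD(2)[OF pbS m(1) q', folded S_def]
  note pbS' = pbS[unfolded is_pullback_iff[OF m(1) q' a n]]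
  have mono_n: "mono_arrow C n" by (rule pullback_mono[OF pbS m(1) q' mono_m])
  obtain j where j: "j \<in> hom C (cosmash C A G) S" "n \<cdot> j = \<iota>'"
    using pbS' \<psi> \<iota>'(1) \<iota>'(3)[symmetric] by blast
  have "m \<cdot> Ide C A = q' \<cdot> \<eta>" using Ide_right[OF m(1)] \<eta>(3) by simp
  then obtain t where t: "t \<in> hom C A S" "n \<cdot> t = \<eta>" using pbS' Ide_in_hom[OF A] \<eta>(1) by blast
  have "iso_arrow C n"
    by (rule split_extension_generated[OF e \<eta>(1) e\<eta> ker_e \<iota>'(1) n mono_n j t])
  then obtain n' where n': "n' \<in> hom C P S" "n \<cdot> n' = Ide C P"
    unfolding iso_arrow_def homD(2,3)[OF n] by blast
  have "m \<cdot> (a \<cdot> n') = q'"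
    using Comp_assoc[OF n'(1) a m(1)] Comp_assoc[OF n'(1) n q'] pbS' n'(2) Ide_right[OF q'] by simp
  then obtain v where v: "v \<in> hom C K A" "m \<cdot> v = Ide C K" "v \<cdot> m = Ide C A"
    using mono_regular_epi_factor_iso[OF m(1) mono_m epi q' Comp_in_hom[OF n'(1) a]] by blast

  \<comment> \<open>With \<open>m\<close> invertible, \<open>l = k \<cdot> m\<close> inherits
    existence of factorizations from \<open>k\<close>; their uniqueness holds because
    \<open>l\<close> is monic.\<close>
  have "is_kernel C p l"
    unfolding is_kernel_iff[OF p(1) l]
  proof (intro conjI allI ballI impI)
    show "p \<cdot> l = zero_arrow C A G" by (rule p(3))
  next
    fix W u
    assume u: "u \<in> hom C W Q" and "p \<cdot> u = zero_arrow C W G"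
    then obtain h where h: "h \<in> hom C W K" "k \<cdot> h = u" using kernel_factor[OF ker p(1) k] by blast
    have "l \<cdot> (v \<cdot> h) = u"
      using Comp_assoc[OF h(1) v(1) l] Comp_assoc[OF v(1) m(1) k] m(2) v(2) Ide_right[OF k] h(2) by simp
    then show "\<exists>!h. h \<in> hom C W A \<and> l \<cdot> h = u"
      using mono_arrowD[OF mono_l[folded defs] l] Comp_in_hom[OF h(1) v(1)] by metis
  qed
  then show ?thesis by (simp add: defs)
qed

section \<open>Conjugation actions and their restriction\<close>

lemma commutator_map_in_hom:
  assumes "E \<in> Obj C"
  shows "commutator_map C E \<in> hom C (cosmash C E E) E"
  unfolding commutator_map_def
  using assms by (intro Comp_in_hom[OF cosmash_incl(2)] copairing(1) Ide_in_hom)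

text \<open>Because \<open>f\<close> annihilates \<open>n\<close>, folding after
  \<open>n + 1\<close> and then applying \<open>f\<close> is the same as
  \<open>f \<cdot> retr2 C N E\<close>, and that retraction annihilates the cosmash inclusion. So
  the commutator composite lands in the kernel \<open>n\<close> of \<open>f\<close>, and the
  definite description is justified.\<close>

lemma conj_action:
  assumes f: "f \<in> hom C E B" and n: "n \<in> hom C N E" and ker: "is_kernel C f n"
  shows "conj_action C N E n \<in> hom C (cosmash C N E) N"
    "n \<cdot> conj_action C N E n = commutator_map C E \<cdot> cosmash_map C n (Ide C E)"
proof -
  note N = homD(4)[OF n] and E = homD(5)[OF n] and B = homD(5)[OF f]
  note idE = Ide_in_hom[OF E]
  note fold = copairing[OF idE idE] and k = cosmash_incl[OF N E] and k' = cosmash_incl[OF E E]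
  note m = coproduct_map[OF n idE] and cm = cosmash_map[OF n idE]
  let ?fold = "copairing C (Ide C E) (Ide C E)"
  let ?u = "commutator_map C E \<cdot> cosmash_map C n (Ide C E)"
  have u: "?u \<in> hom C (cosmash C N E) E" by (rule Comp_in_hom[OF cm(1) commutator_map_in_hom[OF E]])
  note ffold = Comp_in_hom[OF fold(1) f]
  note r = retr2[OF N E]
  have fn: "f \<cdot> n = zero_arrow C N B" using ker unfolding is_kernel_iff[OF f n] by blast
  have c1: "(f \<cdot> ?fold) \<cdot> inj1 C E E = f" "(f \<cdot> ?fold) \<cdot> inj2 C E E = f"
    using Comp_assoc[OF coproduct_facts(1)[OF E E] fold(1) f]
      Comp_assoc[OF coproduct_facts(2)[OF E E] fold(1) f] fold(2,3) Ide_right[OF f] by simp_all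
  have "(f \<cdot> ?fold) \<cdot> coproduct_map C n (Ide C E) = f \<cdot> retr2 C N E"
    by (rule coproduct_ext[OF Comp_in_hom[OF m(1) ffold] Comp_in_hom[OF r(1) f] N E])
      (simp_all add: comp_coproduct_map[OF n idE ffold] c1 fn Ide_right[OF f] r comp_zero[OF f N]
        Comp_assoc[OF coproduct_facts(1)[OF N E] r(1) f]
        Comp_assoc[OF coproduct_facts(2)[OF N E] r(1) f])
  then have 1: "(f \<cdot> ?fold) \<cdot> (coproduct_map C n (Ide C E) \<cdot> cosmash_incl C N E) =
      zero_arrow C (cosmash C N E) B"
    using Comp_assoc[OF k(2) m(1) ffold] Comp_assoc[OF k(2) r(1) f] k(4) comp_zero[OF f homD(4)[OF k(2)]]
    by simp
  have "?u = ?fold \<cdot> (coproduct_map C n (Ide C E) \<cdot> cosmash_incl C N E)"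
    unfolding commutator_map_def using Comp_assoc[OF cm(1) k'(2) fold(1)] cm(2) by simp
  then have "f \<cdot> ?u = zero_arrow C (cosmash C N E) B"
    using 1 Comp_assoc[OF Comp_in_hom[OF k(2) m(1)] fold(1) f] by simp
  then have "\<exists>!c. c \<in> hom C (cosmash C N E) N \<and> n \<cdot> c = ?u"
    using ker u unfolding is_kernel_iff[OF f n] by blast
  from theI'[OF this] show "conj_action C N E n \<in> hom C (cosmash C N E) N"
    "n \<cdot> conj_action C N E n = ?u"
    unfolding conj_action_def by auto
qed

lemma conj_action_restrict:
  assumes act: "is_action C A G \<psi>"
  shows "conj_action C A (act_Q C A G \<psi>) (act_l C A G \<psi>)
    \<cdot> cosmash_map C (Ide C A) (act_s C A G \<psi>) = \<psi>"
proof -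
  have A: "A \<in> Obj C" and G: "G \<in> Obj C" and \<psi>: "\<psi> \<in> hom C (cosmash C A G) A"
    and mono_l: "mono_arrow C (act_l C A G \<psi>)"
    using act unfolding is_action_def by auto
  define q l s E where "q = act_q C A G \<psi>" and "l = act_l C A G \<psi>" and "s = act_s C A G \<psi>"
    and "E = act_Q C A G \<psi>"
  note defs = this
  note q = act_q(2,5)[OF A G \<psi>, folded defs] and l = act_q(3)[OF A G \<psi>, folded defs]
    and s = act_q(4)[OF A G \<psi>, folded defs]
  note mono_l = mono_l[folded defs]
  note E = homD(5)[OF l]
  note idE = Ide_in_hom[OF E] and idA = Ide_in_hom[OF A]
  \<comment> \<open>\<open>conj_action\<close> requires a kernel; here it is \<open>l\<close>, as a
    kernel of the projection \<open>act_p C A G \<psi>\<close> onto \<open>G\<close>.\<close>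
  note c = conj_action[OF act_p(1)[OF A G \<psi>, folded defs] l act_l_kernel[OF act, folded defs]]
  note fold = copairing[OF idE idE] and kEE = cosmash_incl(2)[OF E E] and kAE = cosmash_incl(2)[OF A E]
    and kAG = cosmash_incl(2)[OF A G]
  note ml = coproduct_map[OF l idE] and cl = cosmash_map[OF l idE]
  note ms = coproduct_map[OF idA s] and cs = cosmash_map[OF idA s]
  let ?c = "conj_action C A E l"
  let ?fold = "copairing C (Ide C E) (Ide C E)"
  let ?ml = "coproduct_map C l (Ide C E)" and ?ms = "coproduct_map C (Ide C A) s"
  let ?cl = "cosmash_map C l (Ide C E)" and ?cs = "cosmash_map C (Ide C A) s"
  note foldl = comp_coproduct_map[OF l idE fold(1)]
  note foldls = comp_coproduct_map[OF idA s foldl(1)]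
  \<comment> \<open>On the injections the left side is \<open>l\<close> and \<open>s\<close>, which
    by definition are the restrictions of \<open>q\<close>.\<close>
  have "(?fold \<cdot> ?ml) \<cdot> ?ms = q"
    by (rule coproduct_ext[OF foldls(1) q(1) A G])
      (simp_all add: foldls foldl fold Ide_left[OF l] Ide_right[OF l] Ide_left[OF s] Ide_left[OF idE],
        simp_all add: defs act_l_def act_s_def)
  have "l \<cdot> (?c \<cdot> ?cs) = (commutator_map C E \<cdot> ?cl) \<cdot> ?cs"
    using Comp_assoc[OF cs(1) c(1) l] c(2) by simp
  \<comment> \<open>The defining squares of the two cosmash maps move them past the inclusions one
    after the other, until only arrows out of the sum of \<open>A\<close> and \<open>G\<close>
    remain and the identity for \<open>q\<close> applies.\<close>
  also have "commutator_map C E \<cdot> ?cl = (?fold \<cdot> ?ml) \<cdot> cosmash_incl C A E"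
    unfolding commutator_map_def
    using Comp_assoc[OF cl(1) kEE fold(1)] cl(2) Comp_assoc[OF kAE ml(1) fold(1)] by simp
  also have "((?fold \<cdot> ?ml) \<cdot> cosmash_incl C A E) \<cdot> ?cs = ((?fold \<cdot> ?ml) \<cdot> ?ms) \<cdot> cosmash_incl C A G"
    using Comp_assoc[OF cs(1) kAE foldl(1)] cs(2) Comp_assoc[OF kAG ms(1) foldl(1)] by simp
  also have "\<dots> = l \<cdot> \<psi>" unfolding \<open>(?fold \<cdot> ?ml) \<cdot> ?ms = q\<close> by (rule q(2))
  finally show ?thesis
    using mono_arrowD[OF mono_l l Comp_in_hom[OF cs(1) c(1)] \<psi>] by (simp add: defs)
qed

end

theorem corollary18:
  fixes C :: "('o, 'm) cat" and A G :: 'o and \<psi> :: 'm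
  assumes "homological C"
    and "finitely_cocomplete C"
    and "A \<in> Obj C" and "G \<in> Obj C"
    and "is_action C A G \<psi>"
  shows "conj_action C A (act_Q C A G \<psi>) (act_l C A G \<psi>)
           \<cdot>\<^bsub>C\<^esub> cosmash_map C (Ide C A) (act_s C A G \<psi>) = \<psi>"
proof -
  interpret category C using assms(1) unfolding homological_def by blast
  interpret cocomplete_homological C using assms by unfold_locales
  show ?thesis using conj_action_restrict[OF assms(5)] .
qed

end
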